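(* Let $n\ge 1$ and let $(F_1\times[0,1],L_1)$ and $(F_2\times[0,1],L_2)$ be virtually equivalent elements of $V_n$. Then the spaces $h(F_1)-L_1$ and $h(F_2)-L_2$ are homotopy equivalent. That is, the homotopy type of $h(F)-L$ is invariant under virtual equivalence.
   Context: All manifolds are smooth. $V_n$ is the set of pairs $(F\times[0,1],L)$ where $F$ is a compact $(n+1)$-manifold (possibly with boundary), $F\times[0,1]$ carries the trivial $[0,1]$-bundle structure over $F$, and $L$ is an $n$-manifold smoothly embedded in the interior of $F\times[0,1]$ that meets every component of $F\times[0,1]$. Write $(F_1\times[0,1],L_1)\sim(F_2\times[0,1],L_2)$ if there is an embedding $f:F_1\to F_2$ with $(f\times \mathrm{id}_{[0,1]})(L_1)=L_2$. Virtual equivalence, denoted $\cong$, is the equivalence relation on $V_n$ generated by $\sim$ together with smooth isotopy of the link $L$ in $F\times[0,1]$. For $(F\times[0,1],L)\in V_n$, $h(F)$ denotes the quotient space of $F\times[0,1]$ obtained by identifying $(x,1)$ with $(x',1)$ for all $x,x'\in F$ (i.e. $F\times\{1\}$ is collapsed to one point); $L$ is regarded as a subspace of $h(F)$.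
   Formalization: The link L is taken to be a closed n-manifold (compact, without boundary); for noncompact L the claim fails, e.g. infinitely many circles shrinking to one point can be isotoped so that they accumulate at two points. *)

theory Defs
  imports "HOL-Analysis.Analysis"
begin

section \<open>Smooth functions\<close>

primrec Ck_on :: "nat \<Rightarrow> 'a::euclidean_space set \<Rightarrow> ('a \<Rightarrow> 'b::euclidean_space) \<Rightarrow> bool" where
  "Ck_on 0 = (\<lambda>U g. continuous_on U g)"
| "Ck_on (Suc k) = (\<lambda>U g. (\<forall>x\<in>U. g differentiable (at x)) \<and>
      (\<forall>v. Ck_on k U (\<lambda>x. frechet_derivative g (at x) v)))"

text \<open>\<^const>\<open>Ck_on\<close> is meaningful on open sets only. On an arbitrary set (e.g. a relatively open
  subset of a half space) smoothness means local extendability to a smooth function on an open set.\<close>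

definition smooth_on :: "'a::euclidean_space set \<Rightarrow> ('a \<Rightarrow> 'b::euclidean_space) \<Rightarrow> bool" where
  "smooth_on S f \<longleftrightarrow>
     (\<forall>x\<in>S. \<exists>U g. open U \<and> x \<in> U \<and> (\<forall>k. Ck_on k U g) \<and> (\<forall>y\<in>S \<inter> U. f y = g y))"

section \<open>Smooth manifolds, possibly with boundary or corners\<close>

text \<open>A chart is a pair \<open>(U, \<phi>)\<close>; only the values of \<open>\<phi>\<close> on \<open>U\<close> matter. The atlas need not be
  maximal: everything below depends only on the smooth structure it generates.\<close>

record ('a, 'e) smooth_space =
  mtop :: "'a topology"
  atlas :: "('a set \<times> ('a \<Rightarrow> 'e)) set"

text \<open>The model \<open>H\<close> is the whole space for manifolds without boundary, a closed half space for
  manifolds with boundary, and \<open>half space \<times> [0,1]\<close> for the product of the latter with \<open>[0,1]\<close>.\<close>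

definition smooth_manifold :: "'e::euclidean_space set \<Rightarrow> ('a, 'e) smooth_space \<Rightarrow> bool" where
  "smooth_manifold H M \<longleftrightarrow>
     Hausdorff_space (mtop M) \<and> second_countable (mtop M) \<and>
     (\<Union>(U, \<phi>)\<in>atlas M. U) = topspace (mtop M) \<and>
     (\<forall>(U, \<phi>)\<in>atlas M.
        openin (mtop M) U \<and> openin (top_of_set H) (\<phi> ` U) \<and>
        homeomorphic_map (subtopology (mtop M) U) (top_of_set (\<phi> ` U)) \<phi>) \<and>
     (\<forall>(U, \<phi>)\<in>atlas M. \<forall>(V, \<psi>)\<in>atlas M. smooth_on (\<phi> ` (U \<inter> V)) (\<psi> \<circ> inv_into U \<phi>))"

definition manifold_interior :: "'e::euclidean_space set \<Rightarrow> ('a, 'e) smooth_space \<Rightarrow> 'a set" where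
  "manifold_interior H M = {p. \<exists>(U, \<phi>)\<in>atlas M. p \<in> U \<and> \<phi> p \<in> interior H}"

definition half_space :: "('e::euclidean_space \<times> real) set" where
  "half_space = UNIV \<times> {0..}"

definition prod_manifold ::
    "('a, 'e) smooth_space \<Rightarrow> ('b, 'f) smooth_space \<Rightarrow> ('a \<times> 'b, 'e \<times> 'f) smooth_space" where
  "prod_manifold M N = \<lparr>mtop = prod_topology (mtop M) (mtop N),
     atlas = {(U \<times> V, map_prod \<phi> \<psi>) | U \<phi> V \<psi>. (U, \<phi>) \<in> atlas M \<and> (V, \<psi>) \<in> atlas N}\<rparr>"

definition unit_interval :: "(real, real) smooth_space" where
  "unit_interval = \<lparr>mtop = top_of_set {0..1}, atlas = {({0..1}, id)}\<rparr>"

definition smooth_map ::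
    "('a, 'e::euclidean_space) smooth_space \<Rightarrow> ('b, 'f::euclidean_space) smooth_space \<Rightarrow>
     ('a \<Rightarrow> 'b) \<Rightarrow> bool" where
  "smooth_map M N f \<longleftrightarrow> continuous_map (mtop M) (mtop N) f \<and>
     (\<forall>(U, \<phi>)\<in>atlas M. \<forall>(V, \<psi>)\<in>atlas N.
        smooth_on (\<phi> ` (U \<inter> f -` V)) (\<psi> \<circ> f \<circ> inv_into U \<phi>))"

text \<open>The derivative within the chart image is unique at boundary and corner points too, since the
  models are convex with nonempty interior.\<close>

definition smooth_immersion ::
    "('a, 'e::euclidean_space) smooth_space \<Rightarrow> ('b, 'f::euclidean_space) smooth_space \<Rightarrow>
     ('a \<Rightarrow> 'b) \<Rightarrow> bool" where
  "smooth_immersion M N f \<longleftrightarrow> smooth_map M N f \<and>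
     (\<forall>(U, \<phi>)\<in>atlas M. \<forall>(V, \<psi>)\<in>atlas N. \<forall>p\<in>U \<inter> f -` V.
        \<exists>D. ((\<psi> \<circ> f \<circ> inv_into U \<phi>) has_derivative D) (at (\<phi> p) within \<phi> ` (U \<inter> f -` V)) \<and> inj D)"

definition smooth_embedding ::
    "('a, 'e::euclidean_space) smooth_space \<Rightarrow> ('b, 'f::euclidean_space) smooth_space \<Rightarrow>
     ('a \<Rightarrow> 'b) \<Rightarrow> bool" where
  "smooth_embedding M N f \<longleftrightarrow> smooth_immersion M N f \<and> embedding_map (mtop M) (mtop N) f"

definition closed_manifold :: "('a, 'e::euclidean_space) smooth_space \<Rightarrow> bool" where
  "closed_manifold N \<longleftrightarrow> smooth_manifold UNIV N \<and> compact_space (mtop N)"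

definition compact_manifold_bd :: "('a, 'e::euclidean_space \<times> real) smooth_space \<Rightarrow> bool" where
  "compact_manifold_bd F \<longleftrightarrow> smooth_manifold half_space F \<and> compact_space (mtop F)"

section \<open>Links in thickened manifolds\<close>

text \<open>The dimension \<open>n\<close> is \<open>CARD('n)\<close>, hence an arbitrary positive number.\<close>

abbreviation thick :: "('a, 'e) smooth_space \<Rightarrow> ('a \<times> real, 'e \<times> real) smooth_space" where
  "thick F \<equiv> prod_manifold F unit_interval"

abbreviation thick_interior ::
    "('a, 'e::euclidean_space \<times> real) smooth_space \<Rightarrow> ('a \<times> real) set" where
  "thick_interior F \<equiv> manifold_interior (half_space \<times> {0..1}) (thick F)"

definition embedded_link ::
    "('a, (real^'n) \<times> real) smooth_space \<Rightarrow> ('a \<times> real) set \<Rightarrow> bool" where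
  "embedded_link F L \<longleftrightarrow> L \<subseteq> thick_interior F \<and>
     (\<exists>N :: ('a \<times> real, real^'n) smooth_space.
        closed_manifold N \<and> topspace (mtop N) = L \<and> smooth_embedding N (thick F) id)"

text \<open>The set \<open>V\<^sub>n\<close>; the pair \<open>(F \<times> [0,1], L)\<close> is represented by \<open>(F, L)\<close>.\<close>

definition thick_links :: "(('a, (real^'n) \<times> real) smooth_space \<times> ('a \<times> real) set) set" where
  "thick_links = {(F, L). compact_manifold_bd F \<and> embedded_link F L \<and>
     (\<forall>C\<in>connected_components_of (mtop (thick F)). C \<inter> L \<noteq> {})}"

section \<open>Virtual equivalence\<close>

fun embedding_related ::
    "('a, (real^'n) \<times> real) smooth_space \<times> ('a \<times> real) set \<Rightarrow>
     ('a, (real^'n) \<times> real) smooth_space \<times> ('a \<times> real) set \<Rightarrow> bool" where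
  "embedding_related (F1, L1) (F2, L2) \<longleftrightarrow>
     (\<exists>f. smooth_embedding F1 F2 f \<and> map_prod f id ` L1 = L2)"

text \<open>Isotopy of the link through smooth embeddings into the interior; no ambient isotopy is
  assumed. The source \<open>N\<close> of the isotopy may have any carrier of the type of the link itself,
  which is no restriction up to diffeomorphism.\<close>

fun smoothly_isotopic ::
    "('a, (real^'n) \<times> real) smooth_space \<times> ('a \<times> real) set \<Rightarrow>
     ('a, (real^'n) \<times> real) smooth_space \<times> ('a \<times> real) set \<Rightarrow> bool" where
  "smoothly_isotopic (F1, L1) (F2, L2) \<longleftrightarrow> F1 = F2 \<and>
     (\<exists>(N :: ('a \<times> real, real^'n) smooth_space) E.
        closed_manifold N \<and>
        smooth_map (prod_manifold N unit_interval) (thick F1) E \<and>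
        (\<forall>t\<in>{0..1}. smooth_embedding N (thick F1) (\<lambda>x. E (x, t)) \<and>
           (\<lambda>x. E (x, t)) ` topspace (mtop N) \<subseteq> thick_interior F1) \<and>
        (\<lambda>x. E (x, 0)) ` topspace (mtop N) = L1 \<and>
        (\<lambda>x. E (x, 1)) ` topspace (mtop N) = L2)"

definition virtually_equivalent ::
    "('a, (real^'n) \<times> real) smooth_space \<times> ('a \<times> real) set \<Rightarrow>
     ('a, (real^'n) \<times> real) smooth_space \<times> ('a \<times> real) set \<Rightarrow> bool" where
  "virtually_equivalent p q \<longleftrightarrow> p \<in> thick_links \<and> q \<in> thick_links \<and>
     equivclp (\<lambda>p q. p \<in> thick_links \<and> q \<in> thick_links \<and>
       (embedding_related p q \<or> smoothly_isotopic p q)) p q"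

section \<open>The collapsed space\<close>

definition quotient_topology :: "'a topology \<Rightarrow> ('a \<times> 'a) set \<Rightarrow> 'a set topology" where
  "quotient_topology X R = topology (\<lambda>W. W \<subseteq> topspace X // R \<and> openin X (\<Union>W))"

lemma openin_quotient_topology:
  assumes R: "equiv (topspace X) R"
  shows "openin (quotient_topology X R) W \<longleftrightarrow> W \<subseteq> topspace X // R \<and> openin X (\<Union>W)"
proof -
  have Int: "\<Union>(S \<inter> T) = \<Union>S \<inter> \<Union>T"
    if "S \<subseteq> topspace X // R" "T \<subseteq> topspace X // R" for S T
  proof
    show "\<Union>S \<inter> \<Union>T \<subseteq> \<Union>(S \<inter> T)"
    proof
      fix x assume "x \<in> \<Union>S \<inter> \<Union>T"
      then obtain A B where AB: "A \<in> S" "x \<in> A" "B \<in> T" "x \<in> B" by blast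
      then have "A = B"
        using quotient_disj[OF R, of A B] that by blast
      with AB show "x \<in> \<Union>(S \<inter> T)" by blast
    qed
  qed blast
  have Union: "openin X (\<Union>(\<Union>K))" if "\<forall>W\<in>K. openin X (\<Union>W)" for K
  proof -
    have "\<Union>(\<Union>K) = \<Union>(Union ` K)" by blast
    with that show ?thesis by auto
  qed
  have "istopology (\<lambda>W. W \<subseteq> topspace X // R \<and> openin X (\<Union>W))"
    unfolding istopology_def using Int Union by (auto simp: Union_least)
  then show ?thesis
    by (simp add: quotient_topology_def)
qed

definition top_face_rel :: "('a \<times> real) topology \<Rightarrow> (('a \<times> real) \<times> ('a \<times> real)) set" where
  "top_face_rel X = {(p, q). p \<in> topspace X \<and> q \<in> topspace X \<and> (p = q \<or> snd p = 1 \<and> snd q = 1)}"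

lemma equiv_top_face_rel: "equiv (topspace X) (top_face_rel X)"
  by (rule equivI) (auto simp: top_face_rel_def refl_on_def sym_def trans_def)

definition hspace :: "('a, 'e) smooth_space \<Rightarrow> ('a \<times> real) set topology" where
  "hspace F = quotient_topology (mtop (thick F)) (top_face_rel (mtop (thick F)))"

definition hproj :: "('a, 'e) smooth_space \<Rightarrow> 'a \<times> real \<Rightarrow> ('a \<times> real) set" where
  "hproj F p = top_face_rel (mtop (thick F)) `` {p}"

definition hcomplement :: "('a, 'e) smooth_space \<Rightarrow> ('a \<times> real) set \<Rightarrow> ('a \<times> real) set topology" where
  "hcomplement F L = subtopology (hspace F) (topspace (hspace F) - hproj F ` L)"

lemma quotient_map_hproj: "quotient_map (mtop (thick F)) (hspace F) (hproj F)"
proof -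
  let ?X = "mtop (thick F)" and ?R = "top_face_rel (mtop (thick F))"
  have eq: "equiv (topspace ?X) ?R" by (rule equiv_top_face_rel)
  note op = openin_quotient_topology[OF eq]
  have top: "topspace (hspace F) = topspace ?X // ?R"
  proof
    show "topspace (hspace F) \<subseteq> topspace ?X // ?R"
      using op[of "topspace (hspace F)"] by (simp add: hspace_def)
    have "openin (hspace F) (topspace ?X // ?R)"
      by (simp add: hspace_def op Union_quotient[OF eq])
    then show "topspace ?X // ?R \<subseteq> topspace (hspace F)"
      by (rule openin_subset)
  qed
  have "{x \<in> topspace ?X. hproj F x \<in> W} = \<Union>W" if "W \<subseteq> topspace ?X // ?R" for W
  proof (intro equalityI subsetI)
    fix x assume "x \<in> {x \<in> topspace ?X. hproj F x \<in> W}"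
    then show "x \<in> \<Union>W"
      using equiv_class_self[OF eq, of x] unfolding hproj_def by blast
  next
    fix x assume "x \<in> \<Union>W"
    then obtain A where A: "A \<in> W" "x \<in> A" by blast
    then have "A \<in> topspace ?X // ?R" using that by blast
    then have "A = hproj F x" "x \<in> topspace ?X"
      using A eq Union_quotient[OF eq]
      by (auto simp: hproj_def quotient_def dest: equiv_class_eq[OF eq])
    then show "x \<in> {x \<in> topspace ?X. hproj F x \<in> W}" using A by simp
  qed
  moreover have "hproj F ` topspace ?X = topspace (hspace F)"
    by (auto simp: top hproj_def quotient_def)
  ultimately show ?thesis
    by (auto simp: quotient_map_def top op[folded hspace_def])
qed

end

theory Submission
  imports Defs
begin

text \<open>It suffices to treat the two generating moves.

  \<^emph>\<open>Embeddings.\<close> Over a point of the base that lies under no point of the link, the whole segment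
  can be pushed up to the cone point without meeting the link. Let the base be embedded by \<open>f\<close> in a
  larger one of the same dimension. The shadow of the link is compact and, by invariance of domain, lies
  in the topological interior of the image, so an Urysohn function \<open>w\<close> exists that is \<open>0\<close> on the
  shadow and \<open>1\<close> off that interior. Then \<open>(y, s) \<mapsto> (f\<^sup>-\<^sup>1 y, max s (w y))\<close>, extended by the cone
  point, is a homotopy inverse of the map induced by \<open>f\<close>; both homotopies raise \<open>s\<close> to
  \<open>max s (t * w y)\<close>. This is \<open>embedding_related_homotopy_equivalent\<close>.

  \<^emph>\<open>Isotopies.\<close> The complements of the two ends are even homeomorphic, by a form of isotopy
  extension (\<open>isotopic_homotopy_equivalent\<close>) that replaces the flow of a vector field by perturbations
  of the identity with small Lipschitz constant. By connectedness of \<open>[0,1]\<close> it is enough to move the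
  link from time \<open>t\<^sub>0\<close> to a nearby time \<open>t\<close>. This is done one coordinate patch after another: each point
  \<open>x\<close> of the source manifold gets its own time \<open>\<sigma> x\<close>, and the function \<open>\<sigma>\<close> climbs from \<open>t\<^sub>0\<close> to \<open>t\<close> by
  successively taking maxima with bump functions. A single step changes the link only inside one chart,
  where it displaces points by a vector that depends on the point with a small Lipschitz constant
  (\<open>nearly_constant_time_displacement\<close>: an immersion expands distances by a definite factor, while
  the displacement is small in the \<open>C\<^sup>1\<close> sense). Such a displacement extends by McShane's formula to all
  of Euclidean space, and the identity plus a contraction is a homeomorphism by Banach's fixed point
  theorem (\<open>small_displacement_homeomorphism\<close>). It is supported in a ball inside the chart, so it
  extends by the identity to the thickened manifold, fixes the top face and induces a homeomorphism of
  the cone (\<open>local_move\<close>).\<close>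

section \<open>Strict differentiability\<close>

text \<open>Smoothness enters all estimates through this two-point form of the derivative. Unlike the
  derivative at a point, it also controls difference quotients of points near \<open>x\<close>, and it holds on
  arbitrary sets \<open>S\<close>, because the values of \<open>f\<close> are those of a \<open>C\<^sup>1\<close> map on a ball, where the mean
  value inequality applies to that map minus its derivative at \<open>x\<close>.\<close>

lemma smooth_on_strict_derivative:
  fixes f :: "'a::euclidean_space \<Rightarrow> 'b::euclidean_space"
  assumes "smooth_on S f" "x \<in> S"
  obtains D where "bounded_linear D"
    "\<And>e. e > 0 \<Longrightarrow> \<exists>r>0. \<forall>y\<in>S \<inter> ball x r. \<forall>z\<in>S \<inter> ball x r.
        norm (f y - f z - D (y - z)) \<le> e * norm (y - z)"
proof -
  obtain U g where U: "open U" "x \<in> U" and g: "\<And>k. Ck_on k U g"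
    and fg: "\<And>y. y \<in> S \<inter> U \<Longrightarrow> f y = g y"
    using assms unfolding smooth_on_def by metis
  define D where "D y = frechet_derivative g (at y)" for y
  have "Ck_on (Suc 0) U g" by (rule g)
  then have diff: "\<And>y. y \<in> U \<Longrightarrow> (g has_derivative D y) (at y)"
    and cont: "\<And>v. continuous_on U (\<lambda>y. D y v)"
    unfolding D_def by (auto simp: frechet_derivative_works)
  have lin: "bounded_linear (D y)" if "y \<in> U" for y
    using diff[OF that] by (rule has_derivative_bounded_linear)
  show ?thesis
  proof
    show "bounded_linear (D x)" using lin U by blast
    fix e :: real assume "e > 0"
    define \<epsilon> where "\<epsilon> = e / real DIM('a)"
    have "\<epsilon> > 0" using \<open>e > 0\<close> by (simp add: \<epsilon>_def)
    have "\<forall>\<^sub>F y in nhds x. dist (D y b) (D x b) < \<epsilon>" for b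
    proof -
      have "continuous (at x) (\<lambda>y. D y b)"
        using cont[of b] U by (simp add: continuous_on_eq_continuous_at)
      then show ?thesis
        using \<open>\<epsilon> > 0\<close> by (auto simp: continuous_at_eps_delta eventually_nhds_metric)
    qed
    then have "\<forall>\<^sub>F y in nhds x. \<forall>b\<in>Basis. dist (D y b) (D x b) < \<epsilon>"
      by (simp add: eventually_ball_finite)
    moreover have "\<forall>\<^sub>F y in nhds x. y \<in> U" using U by (simp add: eventually_nhds_in_open)
    ultimately have "\<forall>\<^sub>F y in nhds x. y \<in> U \<and> (\<forall>b\<in>Basis. dist (D y b) (D x b) < \<epsilon>)"
      by eventually_elim blast
    then obtain r where "r > 0"
      and r: "\<And>y. y \<in> ball x r \<Longrightarrow> y \<in> U \<and> (\<forall>b\<in>Basis. dist (D y b) (D x b) < \<epsilon>)"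
      by (auto simp: eventually_nhds_metric dist_commute)
    have on: "onorm (\<lambda>v. D y v - D x v) \<le> e" if "y \<in> ball x r" for y
    proof (rule onorm_le)
      fix v :: 'a
      interpret A: bounded_linear "\<lambda>v. D y v - D x v"
        using lin r[OF that] U by (intro bounded_linear_sub) auto
      have "(\<Sum>b\<in>Basis. (v \<bullet> b) *\<^sub>R (D y b - D x b))
          = (\<lambda>v. D y v - D x v) (\<Sum>b\<in>Basis. (v \<bullet> b) *\<^sub>R b)"
        by (simp only: A.sum A.scaleR)
      then have "norm (D y v - D x v) = norm (\<Sum>b\<in>Basis. (v \<bullet> b) *\<^sub>R (D y b - D x b))"
        by (simp only: euclidean_representation)
      also have "\<dots> \<le> (\<Sum>b\<in>(Basis::'a set). \<epsilon> * norm v)"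
      proof (rule sum_norm_le)
        fix b :: 'a assume b: "b \<in> Basis"
        have "\<bar>v \<bullet> b\<bar> * norm (D y b - D x b) \<le> norm v * \<epsilon>"
          using b r[OF that] by (intro mult_mono) (auto simp: Basis_le_norm dist_norm less_imp_le)
        then show "norm ((v \<bullet> b) *\<^sub>R (D y b - D x b)) \<le> \<epsilon> * norm v" by (simp add: mult.commute)
      qed
      finally show "norm (D y v - D x v) \<le> e * norm v" by (simp add: \<epsilon>_def)
    qed
    have "norm (f y - f z - D x (y - z)) \<le> e * norm (y - z)"
      if "y \<in> S \<inter> ball x r" "z \<in> S \<inter> ball x r" for y z
    proof -
      have "norm ((g y - D x y) - (g z - D x z)) \<le> e * norm (y - z)"
      proof (rule differentiable_bound[where f' = "\<lambda>y v. D y v - D x v"])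
        fix w assume "w \<in> ball x r"
        then have "(g has_derivative D w) (at w within ball x r)"
          using diff r has_derivative_at_withinI by blast
        then show "((\<lambda>y. g y - D x y) has_derivative (\<lambda>v. D w v - D x v)) (at w within ball x r)"
          using bounded_linear.has_derivative[OF lin[OF U(2)] has_derivative_ident]
          by (rule has_derivative_diff)
      qed (use that on in auto)
      moreover have "(g y - D x y) - (g z - D x z) = f y - f z - D x (y - z)"
        using fg[of y] fg[of z] that r lin U
        by (simp add: bounded_linear.linear linear_diff)
      ultimately show ?thesis by simp
    qed
    then show "\<exists>r>0. \<forall>y\<in>S \<inter> ball x r. \<forall>z\<in>S \<inter> ball x r.
        norm (f y - f z - D x (y - z)) \<le> e * norm (y - z)"
      using \<open>r > 0\<close> by blast
  qed
qed

lemma smooth_on_imp_local_lipschitz: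
  fixes f :: "'a::euclidean_space \<Rightarrow> 'b::euclidean_space"
  assumes "smooth_on S f" "x \<in> S"
  shows "\<exists>r>0. \<exists>L. L-lipschitz_on (S \<inter> ball x r) f"
proof -
  obtain D r where D: "bounded_linear D" and "r > 0"
    and r: "\<forall>y\<in>S \<inter> ball x r. \<forall>z\<in>S \<inter> ball x r. norm (f y - f z - D (y - z)) \<le> 1 * norm (y - z)"
    using smooth_on_strict_derivative[OF assms] zero_less_one by metis
  have "(1 + onorm D)-lipschitz_on (S \<inter> ball x r) f"
  proof (rule lipschitz_onI)
    fix y z assume "y \<in> S \<inter> ball x r" "z \<in> S \<inter> ball x r"
    then have "norm (f y - f z - D (y - z)) \<le> 1 * norm (y - z)" using r by blast
    moreover have "norm (D (y - z)) \<le> onorm D * norm (y - z)" using D by (rule onorm)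
    moreover have "norm (f y - f z) \<le> norm (f y - f z - D (y - z)) + norm (D (y - z))"
      using norm_triangle_ineq[of "f y - f z - D (y - z)" "D (y - z)"] by simp
    ultimately show "dist (f y) (f z) \<le> (1 + onorm D) * dist y z"
      by (simp add: dist_norm algebra_simps)
  qed (use onorm_pos_le[OF D] in simp)
  with \<open>r > 0\<close> show ?thesis by blast
qed

section \<open>Extending small displacements to homeomorphisms\<close>

text \<open>McShane's formula: the extension is the infimum of the cones of slope \<open>L\<close> with apex on the graph.\<close>

lemma lipschitz_extension_real:
  fixes f :: "'a::metric_space \<Rightarrow> real"
  assumes "L-lipschitz_on S f"
  obtains h where "L-lipschitz_on UNIV h" "\<And>x. x \<in> S \<Longrightarrow> h x = f x"
proof (cases "S = {}")
  case True
  with lipschitz_on_nonneg[OF assms] show ?thesis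
    by (intro that[of "\<lambda>_. 0"]) (auto intro: lipschitz_onI)
next
  case False
  have L: "L \<ge> 0" and lip: "\<And>x y. x \<in> S \<Longrightarrow> y \<in> S \<Longrightarrow> \<bar>f x - f y\<bar> \<le> L * dist x y"
    using assms by (auto simp: lipschitz_on_def dist_real_def)
  obtain s0 where s0: "s0 \<in> S" using False by blast
  define h where "h x = (INF s\<in>S. f s + L * dist x s)" for x
  have bdd: "bdd_below ((\<lambda>s. f s + L * dist x s) ` S)" for x
  proof (rule bdd_belowI2)
    fix s assume "s \<in> S"
    then have "f s0 - f s \<le> L * dist s0 s" using lip[OF s0] by force
    also have "\<dots> \<le> L * (dist x s0 + dist x s)"
      using L by (intro mult_left_mono dist_triangle3) (auto simp: dist_commute)
    finally show "f s0 - L * dist x s0 \<le> f s + L * dist x s" by (simp add: algebra_simps)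
  qed
  have up: "h x \<le> f s + L * dist x s" if "s \<in> S" for x s
    unfolding h_def by (rule cINF_lower[OF bdd that])
  have le: "h x \<le> h y + L * dist x y" for x y
  proof -
    have "h x - L * dist x y \<le> h y"
      unfolding h_def[of y]
    proof (rule cINF_greatest[OF False])
      fix s assume "s \<in> S"
      have "L * dist x s \<le> L * (dist x y + dist y s)"
        using L by (intro mult_left_mono dist_triangle) auto
      with up[OF \<open>s \<in> S\<close>, of x] show "h x - L * dist x y \<le> f s + L * dist y s"
        by (simp add: algebra_simps)
    qed
    then show ?thesis by simp
  qed
  show ?thesis
  proof
    show "L-lipschitz_on UNIV h"
    proof (rule lipschitz_onI)
      fix x y
      show "dist (h x) (h y) \<le> L * dist x y"
        using le[of x y] le[of y x] by (simp add: dist_real_def abs_le_iff dist_commute)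
    qed (rule L)
    fix x assume x: "x \<in> S"
    have "f x \<le> h x"
      unfolding h_def using lip[OF x] by (intro cINF_greatest[OF False]) fastforce
    with up[OF x, of x] show "h x = f x" by simp
  qed
qed

text \<open>Extending coordinate by coordinate costs a factor of the dimension, which is absorbed by starting from a
  smaller Lipschitz constant.\<close>

lemma lipschitz_extension:
  fixes f :: "'a::metric_space \<Rightarrow> 'b::euclidean_space"
  assumes f: "L-lipschitz_on S f"
  obtains h where "(real DIM('b) * L)-lipschitz_on UNIV h" "\<And>x. x \<in> S \<Longrightarrow> h x = f x"
proof -
  have L: "L \<ge> 0" using f by (rule lipschitz_on_nonneg)
  have "\<exists>h. L-lipschitz_on UNIV h \<and> (\<forall>x\<in>S. h x = f x \<bullet> b)" if b: "b \<in> Basis" for b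
  proof -
    have "L-lipschitz_on S (\<lambda>x. f x \<bullet> b)"
    proof (rule lipschitz_onI)
      fix x y assume "x \<in> S" "y \<in> S"
      have "\<bar>(f x - f y) \<bullet> b\<bar> \<le> norm (f x - f y)" using b by (rule Basis_le_norm)
      also have "\<dots> \<le> L * dist x y"
        using lipschitz_onD[OF f \<open>x \<in> S\<close> \<open>y \<in> S\<close>] by (simp add: dist_norm)
      finally show "dist (f x \<bullet> b) (f y \<bullet> b) \<le> L * dist x y"
        by (simp add: dist_real_def inner_diff_left)
    qed (rule L)
    then show ?thesis by (rule lipschitz_extension_real) blast
  qed
  then obtain h where h: "\<And>b. b \<in> Basis \<Longrightarrow> L-lipschitz_on UNIV (h b)"
      "\<And>b x. b \<in> Basis \<Longrightarrow> x \<in> S \<Longrightarrow> h b x = f x \<bullet> b"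
    by metis
  show ?thesis
  proof
    show "(real DIM('b) * L)-lipschitz_on UNIV (\<lambda>x. \<Sum>b\<in>Basis. h b x *\<^sub>R b)"
    proof (rule lipschitz_onI)
      fix x y
      have "dist (\<Sum>b\<in>Basis. h b x *\<^sub>R b) (\<Sum>b\<in>Basis. h b y *\<^sub>R b)
          = norm (\<Sum>b\<in>Basis. (h b x - h b y) *\<^sub>R b)"
        by (simp add: dist_norm sum_subtractf scaleR_diff_left)
      also have "\<dots> \<le> (\<Sum>b\<in>(Basis::'b set). L * dist x y)"
        using lipschitz_onD[OF h(1)] by (intro sum_norm_le) (simp add: dist_real_def)
      finally show "dist (\<Sum>b\<in>Basis. h b x *\<^sub>R b) (\<Sum>b\<in>Basis. h b y *\<^sub>R b)
          \<le> real DIM('b) * L * dist x y" by simp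
    qed (use L in simp)
    show "(\<Sum>b\<in>Basis. h b x *\<^sub>R b) = f x" if "x \<in> S" for x
      using that h(2) by (simp add: euclidean_representation)
  qed
qed

text \<open>Solving \<open>x + D x = y\<close> means finding a fixed point of the contraction \<open>\<lambda>x. y - D x\<close>. The inverse is
  Lipschitz because \<open>x + D x\<close> shrinks distances at most by the factor \<open>1 - c\<close>.\<close>

lemma identity_plus_contraction_homeomorphism:
  fixes D :: "'a::{banach} \<Rightarrow> 'a"
  assumes D: "c-lipschitz_on UNIV D" and c: "c < 1"
  obtains g where "homeomorphism UNIV UNIV (\<lambda>x. x + D x) g"
proof -
  have c0: "c \<ge> 0" and lip: "\<And>x y. dist (D x) (D y) \<le> c * dist x y"
    using D by (auto simp: lipschitz_on_def)
  have "\<exists>!x. y - D x = x" for y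
    using lip by (intro banach_fix_type[OF c0 c]) (simp add: dist_norm norm_minus_commute)
  moreover have "y - D x = x \<longleftrightarrow> x + D x = y" for x y by (auto simp: algebra_simps)
  ultimately have "\<exists>!x. x + D x = y" for y by simp
  then obtain g where g: "\<And>y. g y + D (g y) = y" "\<And>x. g (x + D x) = x" by metis
  have "dist (g x) (g y) \<le> (1 / (1 - c)) * dist x y" for x y
  proof -
    have "x - y = (g x - g y) + (D (g x) - D (g y))" 
      by (metis add_diff_add g(1))
    then have "dist x y \<ge> dist (g x) (g y) - dist (D (g x)) (D (g y))"
      using norm_diff_ineq[of "g x - g y" "D (g x) - D (g y)"] by (simp only: dist_norm)
    moreover have "dist (D (g x)) (D (g y)) \<le> c * dist (g x) (g y)" by (rule lip)
    ultimately have "(1 - c) * dist (g x) (g y) \<le> dist x y" by (simp add: algebra_simps)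
    with c show ?thesis by (simp add: field_simps)
  qed
  then have "(1 / (1 - c))-lipschitz_on UNIV g" using c by (intro lipschitz_onI) auto
  then have "continuous_on UNIV g" by (rule lipschitz_on_continuous_on)
  moreover have "continuous_on UNIV (\<lambda>x. x + D x)"
    using lipschitz_on_continuous_on[OF D] by (intro continuous_intros)
  ultimately have "homeomorphism UNIV UNIV (\<lambda>x. x + D x) g"
    using g by (intro homeomorphismI) auto
  then show ?thesis by (rule that)
qed

text \<open>The displacement \<open>d\<close>, given on \<open>S\<close> only, is extended by \<open>0\<close> outside the ball. Between a point outside
  the ball and a point that really moves there is a distance of at least \<open>R/2\<close>, so the bound on the size
  of \<open>d\<close> makes the joint function Lipschitz with the same constant.\<close>

lemma small_displacement_homeomorphism:
  fixes d :: "'a::euclidean_space \<Rightarrow> 'a"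
  assumes R: "R > 0" and S: "S \<subseteq> ball b R"
    and k: "k \<ge> 0" "real DIM('a) * k < 1"
    and lip: "\<And>x y. x \<in> S \<Longrightarrow> y \<in> S \<Longrightarrow> norm (d x - d y) \<le> k * norm (x - y)"
    and supp: "\<And>x. x \<in> S \<Longrightarrow> d x \<noteq> 0 \<Longrightarrow> x \<in> ball b (R/2)"
    and small: "\<And>x. x \<in> S \<Longrightarrow> norm (d x) \<le> k * (R/2)"
  obtains f g where "homeomorphism UNIV UNIV f g"
    "\<And>x. x \<in> S \<Longrightarrow> f x = x + d x" "\<And>x. x \<notin> ball b R \<Longrightarrow> f x = x"
proof -
  define d' where "d' x = (if x \<in> S then d x else 0)" for x
  have far: "norm (d x) \<le> k * norm (x - y)" if "x \<in> S" "y \<notin> ball b R" for x y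
  proof (cases "d x = 0")
    case False
    then have "dist b x < R/2" using supp that by auto
    moreover have "dist b y \<le> dist b x + dist x y" by (rule dist_triangle)
    ultimately have "R/2 \<le> norm (x - y)" using that by (simp add: dist_norm)
    then show ?thesis using small[OF that(1)] k(1) mult_left_mono order_trans by blast
  qed (use k in simp)
  have "k-lipschitz_on (S \<union> - ball b R) d'"
  proof (rule lipschitz_onI)
    fix x y assume "x \<in> S \<union> - ball b R" "y \<in> S \<union> - ball b R"
    then show "dist (d' x) (d' y) \<le> k * dist x y"
      using lip[of x y] far[of x y] far[of y x] k(1) unfolding d'_def
      by (auto simp: dist_norm norm_minus_commute)
  qed (rule k)
  then obtain D where D: "(real DIM('a) * k)-lipschitz_on UNIV D"
    "\<And>x. x \<in> S \<union> - ball b R \<Longrightarrow> D x = d' x"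
    by (rule lipschitz_extension) blast
  obtain g where "homeomorphism UNIV UNIV (\<lambda>x. x + D x) g"
    using identity_plus_contraction_homeomorphism[OF D(1) k(2)] .
  then show ?thesis
    by (rule that) (use D(2) S in \<open>auto simp: d'_def\<close>)
qed

section \<open>Maps and homotopies of the collapsed space\<close>

lemma mtop_thick: "mtop (thick F) = prod_topology (mtop F) (top_of_set {0..1})"
  by (simp add: prod_manifold_def unit_interval_def)

lemma hproj_eq_iff:
  assumes "p \<in> topspace (mtop (thick F))" "q \<in> topspace (mtop (thick F))"
  shows "hproj F p = hproj F q \<longleftrightarrow> p = q \<or> snd p = 1 \<and> snd q = 1"
  unfolding hproj_def using eq_equiv_class_iff[OF equiv_top_face_rel assms] assms
  by (simp add: top_face_rel_def)

lemma topspace_hspace: "topspace (hspace F) = hproj F ` topspace (mtop (thick F))"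
  by (rule quotient_imp_surjective_map[OF quotient_map_hproj, symmetric])

text \<open>A link below the top face avoids the cone point, the only class that can have several members.\<close>

lemma hproj_in_link_iff:
  assumes "L \<subseteq> topspace (mtop (thick F))" "\<And>q. q \<in> L \<Longrightarrow> snd q < 1" "p \<in> topspace (mtop (thick F))"
  shows "hproj F p \<in> hproj F ` L \<longleftrightarrow> p \<in> L"
  using assms hproj_eq_iff[of _ F p] by (force simp: image_iff)

lemma topspace_hcomplement:
  assumes "L \<subseteq> topspace (mtop (thick F))" "\<And>q. q \<in> L \<Longrightarrow> snd q < 1"
  shows "topspace (hcomplement F L) = hproj F ` (topspace (mtop (thick F)) - L)"
  using hproj_in_link_iff[OF assms] by (auto simp: hcomplement_def topspace_hspace)

lemma top_face_fixing_homeomorphism_hcomplement: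
  assumes fg: "homeomorphic_maps (mtop (thick F)) (mtop (thick F)) f g"
    and fix1: "\<And>p. p \<in> topspace (mtop (thick F)) \<Longrightarrow> snd p = 1 \<Longrightarrow> f p = p"
    and L: "L \<subseteq> topspace (mtop (thick F))"
  shows "hcomplement F L homeomorphic_space hcomplement F (f ` L)"
proof -
  let ?X = "mtop (thick F)"
  have cont: "continuous_map ?X ?X f" "continuous_map ?X ?X g"
    and gf: "\<And>p. p \<in> topspace ?X \<Longrightarrow> g (f p) = p" "\<And>p. p \<in> topspace ?X \<Longrightarrow> f (g p) = p"
    using fg by (auto simp: homeomorphic_maps_def)
  have fX: "\<And>p. p \<in> topspace ?X \<Longrightarrow> f p \<in> topspace ?X" "\<And>p. p \<in> topspace ?X \<Longrightarrow> g p \<in> topspace ?X"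
    using cont by (auto simp: continuous_map_def Pi_iff)
  have fix2: "\<And>p. p \<in> topspace ?X \<Longrightarrow> snd p = 1 \<Longrightarrow> g p = p"
    using fix1 gf by metis
  have q: "quotient_map ?X (hspace F) (hproj F)" by (rule quotient_map_hproj)
  have hc: "continuous_map ?X (hspace F) (hproj F)" using q by (rule quotient_imp_continuous_map)
  obtain f' where f': "continuous_map (hspace F) (hspace F) f'"
      "\<And>p. p \<in> topspace ?X \<Longrightarrow> f' (hproj F p) = hproj F (f p)"
  proof (rule quotient_map_lift_exists[OF q, of "hspace F" "hproj F \<circ> f"])
    show "continuous_map ?X (hspace F) (hproj F \<circ> f)" using cont(1) hc by (rule continuous_map_compose)
    fix p q assume "p \<in> topspace ?X" "q \<in> topspace ?X" "hproj F p = hproj F q"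
    then show "(hproj F \<circ> f) p = (hproj F \<circ> f) q"
      using hproj_eq_iff[of p F q] fix1[of p] fix1[of q] by auto
  qed auto
  obtain g' where g': "continuous_map (hspace F) (hspace F) g'"
      "\<And>p. p \<in> topspace ?X \<Longrightarrow> g' (hproj F p) = hproj F (g p)"
  proof (rule quotient_map_lift_exists[OF q, of "hspace F" "hproj F \<circ> g"])
    show "continuous_map ?X (hspace F) (hproj F \<circ> g)" using cont(2) hc by (rule continuous_map_compose)
    fix p q assume "p \<in> topspace ?X" "q \<in> topspace ?X" "hproj F p = hproj F q"
    then show "(hproj F \<circ> g) p = (hproj F \<circ> g) q"
      using hproj_eq_iff[of p F q] fix2[of p] fix2[of q] by auto
  qed auto
  have hm: "homeomorphic_maps (hspace F) (hspace F) f' g'"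
    unfolding homeomorphic_maps_def using f' g' gf fX by (auto simp: topspace_hspace)
  have im: "f' ` (hproj F ` L) = hproj F ` (f ` L)"
    unfolding image_image by (rule image_cong) (use f'(2) L in auto)
  have inj: "inj_on f' (topspace (hspace F))" "f' ` topspace (hspace F) = topspace (hspace F)"
    using hm homeomorphic_imp_injective_map homeomorphic_imp_surjective_map
    by (metis homeomorphic_maps_map)+
  have "hproj F ` L \<subseteq> topspace (hspace F)" using L by (auto simp: topspace_hspace)
  then have "f' ` (topspace (hspace F) - hproj F ` L) = topspace (hspace F) - hproj F ` (f ` L)"
    by (simp add: inj_on_image_set_diff[OF inj(1)] inj(2) im)
  then have "homeomorphic_maps (hcomplement F L) (hcomplement F (f ` L)) f' g'"
    unfolding hcomplement_def by (intro homeomorphic_maps_subtopologies[OF hm]) (simp add: Int_absorb1)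
  then show ?thesis by (auto simp: homeomorphic_space_def)
qed

text \<open>The homotopy raises the height \<open>s\<close> over \<open>x\<close> to \<open>max s (t * w x)\<close>. It moves only points over which
  \<open>w\<close> is positive; over those there is no link to be hit. It descends to the quotient at all times
  simultaneously because the product of a quotient map with a compact interval is a quotient map.\<close>

lemma homotopic_push_to_cone_point:
  fixes c :: "('a \<times> real) set \<Rightarrow> ('a \<times> real) set" and F :: "('a, 'e) smooth_space"
  assumes lam: "continuous_map (mtop F) (top_of_set {0..1}) w"
    and lamL: "\<And>p. p \<in> L \<Longrightarrow> w (fst p) = 0"
    and L: "L \<subseteq> topspace (mtop (thick F))" "\<And>q. q \<in> L \<Longrightarrow> snd q < 1"
    and c: "\<And>p. p \<in> topspace (mtop (thick F)) \<Longrightarrow>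
              c (hproj F p) = hproj F (fst p, max (snd p) (w (fst p)))"
  shows "homotopic_with (\<lambda>_. True) (hcomplement F L) (hcomplement F L) c id"
proof -
  let ?I = "top_of_set {0..1::real}" and ?X = "mtop (thick F)"
  have lam01: "0 \<le> w x" "w x \<le> 1" if "x \<in> topspace (mtop F)" for x
    using lam that by (auto simp: continuous_map_def Pi_iff)
  have "continuous_map (prod_topology ?I ?X) ?X (\<lambda>z. (fst (snd z), max (snd (snd z)) (fst z * w (fst (snd z)))))"
  proof -
    let ?P = "prod_topology ?I ?X"
    have 0: "continuous_map ?P ?X snd" "continuous_map ?P ?I fst" by (auto intro: continuous_intros)
    have 1: "continuous_map ?P (mtop F) (\<lambda>z. fst (snd z))"
      using continuous_map_fst_of[OF 0(1)[unfolded mtop_thick]] by (simp add: mtop_thick o_def)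
    have 2: "continuous_map ?P euclideanreal (\<lambda>z. snd (snd z))"
      using continuous_map_snd_of[OF 0(1)[unfolded mtop_thick]]
      by (simp add: mtop_thick o_def continuous_map_in_subtopology)
    have 3: "continuous_map ?P euclideanreal fst"
      using 0(2) by (simp add: continuous_map_in_subtopology)
    have 4: "continuous_map ?P euclideanreal (\<lambda>z. w (fst (snd z)))"
      using continuous_map_compose[OF 1 lam] by (simp add: o_def continuous_map_in_subtopology)
    have 5: "continuous_map ?P euclideanreal (\<lambda>z. max (snd (snd z)) (fst z * w (fst (snd z))))"
      using 2 3 4 by (intro continuous_intros)
    then have "continuous_map ?P ?I (\<lambda>z. max (snd (snd z)) (fst z * w (fst (snd z))))"
      using lam01 by (auto simp: continuous_map_in_subtopology mtop_thick mult_le_one le_max_iff_disj)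
    then show ?thesis using 1 by (simp add: mtop_thick continuous_map_paired)
  qed
  then have k: "continuous_map (prod_topology ?I ?X) (hspace F)
      (\<lambda>z. hproj F (fst (snd z), max (snd (snd z)) (fst z * w (fst (snd z)))))" (is "continuous_map _ _ ?k")
    using continuous_map_compose[OF _ quotient_imp_continuous_map[OF quotient_map_hproj]]
    by (fastforce simp: o_def)
  have q: "quotient_map (prod_topology ?I ?X) (prod_topology ?I (hspace F)) (\<lambda>(t, p). (t, hproj F p))"
    by (intro quotient_map_prod_right quotient_map_hproj)
      (simp_all add: Hausdorff_space_subtopology compact_imp_locally_compact_space
        compact_space_subtopology)
  have resp: "?k x = ?k y" if "x \<in> topspace (prod_topology ?I ?X)" "y \<in> topspace (prod_topology ?I ?X)"
    and eq: "(\<lambda>(t, p). (t, hproj F p)) x = (\<lambda>(t, p). (t, hproj F p)) y" for x y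
  proof -
    obtain t p where x: "x = (t, p)" by (rule prod.exhaust)
    obtain u q where y: "y = (u, q)" by (rule prod.exhaust)
    have pq: "p \<in> topspace ?X" "q \<in> topspace ?X" "t \<in> {0..1}" "u = t" "hproj F p = hproj F q"
      using that by (auto simp: x y)
    have "t * w (fst p) \<le> 1" "t * w (fst q) \<le> 1"
      using lam01[of "fst p"] lam01[of "fst q"] pq(1-3)
      by (simp_all add: mtop_thick mult_le_one mem_Times_iff)
    moreover have "p = q \<or> snd p = 1 \<and> snd q = 1" using hproj_eq_iff[OF pq(1,2)] pq by blast
    moreover have "hproj F (fst p, 1) = hproj F (fst q, 1)"
      using pq(1,2) by (subst hproj_eq_iff) (auto simp: mtop_thick)
    ultimately show ?thesis using pq(4) by (auto simp: x y max_absorb1)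
  qed
  obtain K where K: "continuous_map (prod_topology ?I (hspace F)) (hspace F) K"
    and Keq: "\<And>z. z \<in> topspace (prod_topology ?I ?X) \<Longrightarrow> K ((\<lambda>(t, p). (t, hproj F p)) z) = ?k z"
    by (rule quotient_map_lift_exists[OF q k resp]) blast+
  have Keq': "K (t, hproj F p) = hproj F (fst p, max (snd p) (t * w (fst p)))"
    if "t \<in> {0..1}" "p \<in> topspace ?X" for t p
    using Keq[of "(t, p)"] that by simp
  have ts: "topspace (hcomplement F L) = hproj F ` (topspace ?X - L)"
    using L by (rule topspace_hcomplement)
  have "homotopic_with (\<lambda>_. True) (hcomplement F L) (hcomplement F L) id c"
  proof (subst homotopic_with, simp, intro exI[of _ K] conjI ballI)
    have "K (t, hproj F p) \<in> hproj F ` (topspace ?X - L)"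
      if t: "t \<in> {0..1}" and p: "p \<in> topspace ?X - L" for t p
    proof -
      let ?q = "(fst p, max (snd p) (t * w (fst p)))"
      have "?q \<in> topspace ?X"
        using p t lam01[of "fst p"] by (auto simp: mtop_thick mult_le_one le_max_iff_disj)
      moreover have "?q \<notin> L"
      proof
        assume "?q \<in> L"
        then have "w (fst p) = 0" using lamL by force
        moreover have "0 \<le> snd p" using p by (auto simp: mtop_thick)
        ultimately have "?q = p" by (simp add: max_absorb1)
        with \<open>?q \<in> L\<close> p show False by simp
      qed
      ultimately show ?thesis using Keq'[of t p] p t by blast
    qed
    then have im: "K ` ({0..1} \<times> topspace (hcomplement F L)) \<subseteq> topspace (hcomplement F L)"
      by (auto simp: ts)
    have "continuous_map (subtopology (prod_topology ?I (hspace F)) ({0..1} \<times> topspace (hcomplement F L)))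
        (subtopology (hspace F) (topspace (hcomplement F L))) K"
      using im by (intro continuous_map_into_subtopology continuous_map_from_subtopology K) auto
    moreover have "subtopology (hspace F) (topspace (hcomplement F L)) = hcomplement F L"
      by (simp add: hcomplement_def Int_absorb1)
    ultimately show "continuous_map (prod_topology ?I (hcomplement F L)) (hcomplement F L) K"
      by (simp add: subtopology_Times subtopology_subtopology)
  next
    fix x assume "x \<in> topspace (hcomplement F L)"
    then obtain p where "x = hproj F p" "p \<in> topspace ?X" by (auto simp: ts)
    then show "K (0, x) = id x" "K (1, x) = c x"
      using Keq'[of 0 p] Keq'[of 1 p] c by (auto simp: mtop_thick max_absorb1)
  qed simp
  then show ?thesis by (rule homotopic_with_symD)
qed

lemma continuous_map_hcomplement_restrict:
  assumes c: "continuous_map (hspace F) (hspace G) c"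
    and L: "L \<subseteq> topspace (mtop (thick F))" "\<And>q. q \<in> L \<Longrightarrow> snd q < 1"
    and K: "K \<subseteq> topspace (mtop (thick G))" "\<And>q. q \<in> K \<Longrightarrow> snd q < 1"
    and avoid: "\<And>p. p \<in> topspace (mtop (thick F)) \<Longrightarrow> p \<notin> L \<Longrightarrow>
      \<exists>q \<in> topspace (mtop (thick G)) - K. c (hproj F p) = hproj G q"
  shows "continuous_map (hcomplement F L) (hcomplement G K) c"
proof -
  have "c ` topspace (hcomplement F L) \<subseteq> topspace (hspace G) - hproj G ` K"
    using avoid hproj_in_link_iff[OF K]
    by (fastforce simp: topspace_hcomplement[OF L] topspace_hspace)
  moreover have "continuous_map (hcomplement F L) (hspace G) c"
    unfolding hcomplement_def by (rule continuous_map_from_subtopology[OF c])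
  ultimately show ?thesis
    unfolding hcomplement_def[of G] by (intro continuous_map_into_subtopology) auto
qed

text \<open>Everything outside the image of \<open>f\<close> is collapsed to the cone point. The Urysohn function \<open>w\<close> makes
  this continuous: towards the frontier of the image the height is already forced up to \<open>1\<close>. Both
  composites are pushes to the cone point, along \<open>w\<close> and \<open>w \<circ> f\<close> respectively. The base point \<open>x0\<close> is
  needed to have a cone point at all.\<close>

lemma codim0_embedding_hcomplement_homotopy_equivalent:
  fixes F1 :: "('a, 'e) smooth_space" and F2 :: "('b, 'f) smooth_space"
  assumes F2: "compact_space (mtop F2)" "Hausdorff_space (mtop F2)" and F1: "compact_space (mtop F1)"
    and emb: "embedding_map (mtop F1) (mtop F2) f"
    and L1: "L1 \<subseteq> topspace (mtop (thick F1))" "\<And>q. q \<in> L1 \<Longrightarrow> snd q < 1"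
    and L2: "L2 = map_prod f id ` L1"
    and closed: "closedin (mtop F2) (fst ` L2)"
    and inter: "fst ` L2 \<subseteq> mtop F2 interior_of (f ` topspace (mtop F1))"
    and x0: "x0 \<in> topspace (mtop F1)"
  shows "hcomplement F1 L1 homotopy_equivalent_space hcomplement F2 L2"
proof -
  let ?X1 = "mtop F1" and ?X2 = "mtop F2"
  let ?A = "f ` topspace ?X1" and ?O = "?X2 interior_of (f ` topspace ?X1)"
  have f: "continuous_map ?X1 ?X2 f" using emb
    by (auto simp: embedding_map_def dest: homeomorphic_imp_continuous_map continuous_map_into_fulltopology)
  have fX: "f x \<in> topspace ?X2" if "x \<in> topspace ?X1" for x
    using f that by (auto simp: continuous_map_def Pi_iff)
  obtain g where g: "homeomorphic_maps ?X1 (subtopology ?X2 ?A) f g"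
    using emb by (auto simp: embedding_map_def homeomorphic_map_maps)
  have gcont: "continuous_map (subtopology ?X2 ?A) ?X1 g"
    and gf: "\<And>x. x \<in> topspace ?X1 \<Longrightarrow> g (f x) = x" using g by (auto simp: homeomorphic_maps_def)
  have Acl: "closedin ?X2 ?A"
    using image_compactin[OF _ f, of "topspace ?X1"] F1 F2 by (auto simp: compact_space_def
        intro: compactin_imp_closedin)
  have Asub: "?A \<subseteq> topspace ?X2" using fX by auto
  have OA: "?O \<subseteq> ?A" by (rule interior_of_subset)
  obtain w where w: "continuous_map ?X2 (top_of_set {0..1::real}) w"
    and w0: "w ` (fst ` L2) \<subseteq> {0}" and w1: "w ` (topspace ?X2 - ?O) \<subseteq> {1}"
    by (rule Urysohn_lemma[of ?X2 "fst ` L2" "topspace ?X2 - ?O" 0 1])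
      (use F2 inter closed in \<open>auto simp: compact_Hausdorff_or_regular_imp_normal_space disjnt_def\<close>)
  have w01: "0 \<le> w y" "w y \<le> 1" if "y \<in> topspace ?X2" for y
    using w that by (auto simp: continuous_map_def Pi_iff)
  have L2': "L2 \<subseteq> topspace (mtop (thick F2))" "\<And>q. q \<in> L2 \<Longrightarrow> snd q < 1"
    using L1 fX by (auto simp: L2 mtop_thick)
  have L2iff: "(f x, s) \<in> L2 \<longleftrightarrow> (x, s) \<in> L1" if "x \<in> topspace ?X1" for x s
  proof
    assume "(f x, s) \<in> L2"
    then obtain x' where x': "(x', s) \<in> L1" "f x' = f x" by (auto simp: L2)
    then have "x' \<in> topspace ?X1" using L1(1) by (auto simp: mtop_thick)
    then show "(x, s) \<in> L1" using x' gf that by metis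
  qed (force simp: L2)
  have "continuous_map (mtop (thick F1)) (mtop (thick F2)) (map_prod f id)"
    using f by (simp add: mtop_thick map_prod_def continuous_map_prod_top)
  then have "continuous_map (mtop (thick F1)) (hspace F2) (hproj F2 \<circ> map_prod f id)"
    using quotient_imp_continuous_map[OF quotient_map_hproj] by (rule continuous_map_compose)
  then obtain i where i: "continuous_map (hspace F1) (hspace F2) i"
    and ieq: "\<And>p. p \<in> topspace (mtop (thick F1)) \<Longrightarrow> i (hproj F1 p) = (hproj F2 \<circ> map_prod f id) p"
  proof (rule quotient_map_lift_exists[OF quotient_map_hproj])
    fix p q assume pq: "p \<in> topspace (mtop (thick F1))" "q \<in> topspace (mtop (thick F1))"
      "hproj F1 p = hproj F1 q"
    then have "map_prod f id p = map_prod f id q \<or> snd (map_prod f id p) = 1 \<and> snd (map_prod f id q) = 1"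
      using hproj_eq_iff[of p F1 q] by auto
    moreover have "map_prod f id p \<in> topspace (mtop (thick F2))" "map_prod f id q \<in> topspace (mtop (thick F2))"
      using pq fX by (auto simp: mtop_thick)
    ultimately show "(hproj F2 \<circ> map_prod f id) p = (hproj F2 \<circ> map_prod f id) q"
      by (simp add: hproj_eq_iff)
  qed blast
  \<comment> \<open>the homotopy inverse: over the frontier of the image \<open>w\<close> is 1, so both cases give the cone point\<close>
  define G where "G p = (if fst p \<in> ?A then hproj F1 (g (fst p), max (snd p) (w (fst p)))
      else hproj F1 (x0, 1))" for p
  have cone: "hproj F1 (x, 1) = hproj F1 (x0, 1)" if "x \<in> topspace ?X1" for x
    using that x0 by (subst hproj_eq_iff) (auto simp: mtop_thick)
  have Gin: "G (f x, s) = hproj F1 (x, max s (w (f x)))" if "x \<in> topspace ?X1" for x s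
    using that gf by (auto simp: G_def)
  have Gcont: "continuous_map (mtop (thick F2)) (hspace F1) G"
  proof (rule pasting_lemma_closed[where I = "{True, False}"
        and T = "\<lambda>b. if b then ?A \<times> {0..1} else (topspace ?X2 - ?O) \<times> {0..1}"
        and f = "\<lambda>b p. if b then hproj F1 (g (fst p), max (snd p) (w (fst p))) else hproj F1 (x0, 1)"])
    fix b :: bool
    show "closedin (mtop (thick F2)) (if b then ?A \<times> {0..1} else (topspace ?X2 - ?O) \<times> {0..1})"
      using Acl by (auto simp: mtop_thick closedin_prod_Times_iff openin_interior_of intro!: closedin_diff)
    show "continuous_map (subtopology (mtop (thick F2)) (if b then ?A \<times> {0..1} else (topspace ?X2 - ?O) \<times> {0..1}))
        (hspace F1) (\<lambda>p. if b then hproj F1 (g (fst p), max (snd p) (w (fst p))) else hproj F1 (x0, 1))"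
    proof (cases b)
      case True
      let ?P = "prod_topology (subtopology ?X2 ?A) (top_of_set {0..1::real})"
      have 0: "continuous_map ?P (subtopology ?X2 ?A) fst" "continuous_map ?P (top_of_set {0..1::real}) snd"
        by (auto intro: continuous_intros)
      have 1: "continuous_map ?P ?X1 (\<lambda>p. g (fst p))"
        using continuous_map_compose[OF 0(1) gcont] by (simp add: o_def)
      have 2: "continuous_map ?P euclideanreal snd" "continuous_map ?P euclideanreal (\<lambda>p. w (fst p))"
        using 0 continuous_map_compose[OF continuous_map_into_fulltopology[OF 0(1)] w]
        by (auto simp: o_def continuous_map_in_subtopology)
      have 3: "continuous_map ?P euclideanreal (\<lambda>p. max (snd p) (w (fst p)))"
        using 2 by (intro continuous_intros)
      then have "continuous_map ?P (top_of_set {0..1}) (\<lambda>p. max (snd p) (w (fst p)))"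
        using w01 by (auto simp: continuous_map_in_subtopology le_max_iff_disj)
      then have "continuous_map ?P (mtop (thick F1)) (\<lambda>p. (g (fst p), max (snd p) (w (fst p))))"
        using 1 by (simp add: mtop_thick continuous_map_paired)
      from continuous_map_compose[OF this quotient_imp_continuous_map[OF quotient_map_hproj]]
      show ?thesis using True by (simp add: mtop_thick subtopology_Times subtopology_subtopology o_def)
    next
      case False
      then show ?thesis using x0 by (auto simp: topspace_hspace mtop_thick)
    qed
  next
    fix b c p assume "p \<in> topspace (mtop (thick F2)) \<inter> (if b then ?A \<times> {0..1} else (topspace ?X2 - ?O) \<times> {0..1})
      \<inter> (if c then ?A \<times> {0..1} else (topspace ?X2 - ?O) \<times> {0..1})"
    moreover have "hproj F1 (g (fst p), max (snd p) (w (fst p))) = hproj F1 (x0, 1)"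
      if "fst p \<in> ?A" "fst p \<in> topspace ?X2 - ?O" "snd p \<in> {0..1}"
    proof -
      have "w (fst p) = 1" using w1 that by blast
      moreover have "g (fst p) \<in> topspace ?X1" using that gf by auto
      ultimately show ?thesis using that cone by (simp add: max_absorb2)
    qed
    ultimately show "(if b then hproj F1 (g (fst p), max (snd p) (w (fst p))) else hproj F1 (x0, 1))
       = (if c then hproj F1 (g (fst p), max (snd p) (w (fst p))) else hproj F1 (x0, 1))"
      by (auto simp: mem_Times_iff split: if_splits)
  next
    fix p assume "p \<in> topspace (mtop (thick F2))"
    then show "\<exists>b. b \<in> {True, False} \<and> p \<in> (if b then ?A \<times> {0..1} else (topspace ?X2 - ?O) \<times> {0..1})
       \<and> G p = (if b then hproj F1 (g (fst p), max (snd p) (w (fst p))) else hproj F1 (x0, 1))"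
      using OA by (intro exI[of _ "fst p \<in> ?A"]) (auto simp: G_def mtop_thick mem_Times_iff)
  qed simp
  have Gtop: "G p = hproj F1 (x0, 1)" if "p \<in> topspace (mtop (thick F2))" "snd p = 1" for p
    using that cone gf w01 by (auto simp: G_def mtop_thick mem_Times_iff max_absorb1)
  obtain r where r: "continuous_map (hspace F2) (hspace F1) r"
    and req: "\<And>p. p \<in> topspace (mtop (thick F2)) \<Longrightarrow> r (hproj F2 p) = G p"
  proof (rule quotient_map_lift_exists[OF quotient_map_hproj Gcont])
    fix p q assume "p \<in> topspace (mtop (thick F2))" "q \<in> topspace (mtop (thick F2))"
      "hproj F2 p = hproj F2 q"
    then show "G p = G q" using hproj_eq_iff[of p F2 q] Gtop[of p] Gtop[of q] by auto
  qed blast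
  have ri: "homotopic_with (\<lambda>_. True) (hcomplement F1 L1) (hcomplement F1 L1) (r \<circ> i) id"
  proof (rule homotopic_push_to_cone_point[where w = "w \<circ> f"])
    show "continuous_map ?X1 (top_of_set {0..1}) (w \<circ> f)" using f w by (rule continuous_map_compose)
    show "(w \<circ> f) (fst p) = 0" if "p \<in> L1" for p
      using w0 that by (force simp: L2)
    show "(r \<circ> i) (hproj F1 p) = hproj F1 (fst p, max (snd p) ((w \<circ> f) (fst p)))"
      if "p \<in> topspace (mtop (thick F1))" for p
      using that ieq[OF that] req[of "map_prod f id p"] Gin[of "fst p" "snd p"] fX[of "fst p"]
      by (auto simp: mtop_thick mem_Times_iff map_prod_def split: prod.splits)
  qed (use L1 in auto)
  have ir: "homotopic_with (\<lambda>_. True) (hcomplement F2 L2) (hcomplement F2 L2) (i \<circ> r) id"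
  proof (rule homotopic_push_to_cone_point[OF w])
    show "w (fst p) = 0" if "p \<in> L2" for p using w0 that by force
    show "(i \<circ> r) (hproj F2 p) = hproj F2 (fst p, max (snd p) (w (fst p)))"
      if p: "p \<in> topspace (mtop (thick F2))" for p
    proof (cases "fst p \<in> ?A")
      case True
      then obtain x where x: "x \<in> topspace ?X1" "fst p = f x" by blast
      then have "(x, max (snd p) (w (f x))) \<in> topspace (mtop (thick F1))"
        using p w01[of "f x"] by (auto simp: mtop_thick mem_Times_iff le_max_iff_disj)
      then show ?thesis using x req[OF p] Gin[OF x(1), of "snd p"] ieq
        by (metis comp_apply fst_conv map_prod_simp id_apply prod.collapse)
    next
      case False
      then have "w (fst p) = 1" using w1 p OA by (auto simp: mtop_thick mem_Times_iff)
      moreover have "(x0, 1) \<in> topspace (mtop (thick F1))" using x0 by (simp add: mtop_thick)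
      ultimately have "(i \<circ> r) (hproj F2 p) = hproj F2 (f x0, 1)"
        using False req[OF p] ieq[of "(x0, 1)"] by (simp add: G_def)
      also have "\<dots> = hproj F2 (fst p, 1)"
        using p fX[OF x0] by (subst hproj_eq_iff) (auto simp: mtop_thick)
      finally show ?thesis using \<open>w (fst p) = 1\<close> p by (simp add: mtop_thick mem_Times_iff max_absorb2)
    qed
  qed (use L2' in auto)
  have ic: "continuous_map (hcomplement F1 L1) (hcomplement F2 L2) i"
  proof (rule continuous_map_hcomplement_restrict[OF i L1 L2'])
    fix p assume "p \<in> topspace (mtop (thick F1))" "p \<notin> L1"
    then show "\<exists>q\<in>topspace (mtop (thick F2)) - L2. i (hproj F1 p) = hproj F2 q"
      using ieq[of p] L2iff[of "fst p" "snd p"] fX[of "fst p"]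
      by (intro bexI[of _ "map_prod f id p"]) (auto simp: mtop_thick)
  qed auto
  have rc: "continuous_map (hcomplement F2 L2) (hcomplement F1 L1) r"
  proof (rule continuous_map_hcomplement_restrict[OF r L2' L1])
    fix p assume p: "p \<in> topspace (mtop (thick F2))" "p \<notin> L2"
    show "\<exists>q\<in>topspace (mtop (thick F1)) - L1. r (hproj F2 p) = hproj F1 q"
    proof (cases "fst p \<in> ?A")
      case True
      then obtain x where x: "x \<in> topspace ?X1" "fst p = f x" by blast
      then have "(x, max (snd p) (w (f x))) \<in> topspace (mtop (thick F1))"
        using p w01[of "f x"] by (auto simp: mtop_thick mem_Times_iff le_max_iff_disj)
      moreover have "(x, max (snd p) (w (f x))) \<notin> L1"
      proof
        assume *: "(x, max (snd p) (w (f x))) \<in> L1"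
        then have "f x \<in> fst ` L2" by (force simp: L2)
        then have "w (f x) = 0" using w0 by blast
        then have "(x, snd p) \<in> L1" using * p by (auto simp: mtop_thick mem_Times_iff max_absorb1)
        then show False using L2iff[OF x(1), of "snd p"] p x by (metis prod.collapse)
      qed
      moreover have "r (hproj F2 p) = hproj F1 (x, max (snd p) (w (f x)))"
        using req[OF p(1)] Gin[OF x(1), of "snd p"] x by (metis prod.collapse)
      ultimately show ?thesis by blast
    next
      case False
      then have "r (hproj F2 p) = hproj F1 (x0, 1)" using req[OF p(1)] by (simp add: G_def)
      moreover have "(x0, 1) \<in> topspace (mtop (thick F1)) - L1" using x0 L1(2)[of "(x0, 1)"]
        by (auto simp: mtop_thick)
      ultimately show ?thesis by blast
    qed
  qed auto
  show ?thesis unfolding homotopy_equivalent_space_def using ic rc ri ir by blast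
qed

section \<open>Links under embeddings of the base\<close>

lemma chart_properties:
  assumes "smooth_manifold H M" "(U, \<phi>) \<in> atlas M"
  shows "openin (mtop M) U" "openin (top_of_set H) (\<phi> ` U)" "inj_on \<phi> U"
    "homeomorphic_maps (subtopology (mtop M) U) (top_of_set (\<phi> ` U)) \<phi> (inv_into U \<phi>)"
proof -
  have U: "openin (mtop M) U" "openin (top_of_set H) (\<phi> ` U)"
    and h: "homeomorphic_map (subtopology (mtop M) U) (top_of_set (\<phi> ` U)) \<phi>"
    using assms unfolding smooth_manifold_def by blast+
  show "openin (mtop M) U" "openin (top_of_set H) (\<phi> ` U)" by fact+
  have top: "topspace (subtopology (mtop M) U) = U"
    using openin_subset[OF U(1)] by auto
  show inj: "inj_on \<phi> U" using homeomorphic_imp_injective_map[OF h] top by simp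
  obtain \<psi> where \<psi>: "homeomorphic_maps (subtopology (mtop M) U) (top_of_set (\<phi> ` U)) \<phi> \<psi>"
    using h by (auto simp: homeomorphic_map_maps)
  have "inv_into U \<phi> y = \<psi> y" if "y \<in> \<phi> ` U" for y
    using that \<psi> inj top unfolding homeomorphic_maps_def
    by (auto simp: inv_into_f_f)
  then show "homeomorphic_maps (subtopology (mtop M) U) (top_of_set (\<phi> ` U)) \<phi> (inv_into U \<phi>)"
    using homeomorphic_maps_eq[OF \<psi>, of \<phi> "inv_into U \<phi>"] by simp
qed

lemma atlas_thick: "atlas (thick F) = (\<lambda>(U, \<phi>). (U \<times> {0..1}, map_prod \<phi> id)) ` atlas F"
  by (auto simp: prod_manifold_def unit_interval_def image_iff)

lemma thick_interior_iff:
  "p \<in> thick_interior F \<longleftrightarrow>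
     (\<exists>(U, \<phi>)\<in>atlas F. fst p \<in> U \<and> \<phi> (fst p) \<in> interior half_space \<and> 0 < snd p \<and> snd p < 1)"
proof -
  have "interior ((half_space :: ('b \<times> real) set) \<times> {0..1::real}) = interior half_space \<times> {0<..<1}"
    by (simp add: interior_Times interior_atLeastAtMost_real)
  then show ?thesis
    unfolding manifold_interior_def atlas_thick
    by (cases p) (auto simp: case_prod_unfold)
qed

lemma thick_interior_subset:
  assumes "smooth_manifold half_space F"
  shows "thick_interior F \<subseteq> topspace (mtop (thick F))"
proof
  fix p assume "p \<in> thick_interior F"
  then obtain U \<phi> where "(U, \<phi>) \<in> atlas F" "fst p \<in> U" "0 < snd p" "snd p < 1"
    by (auto simp: thick_interior_iff)
  moreover have "U \<subseteq> topspace (mtop F)"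
    using chart_properties(1)[OF assms \<open>(U, \<phi>) \<in> atlas F\<close>] by (rule openin_subset)
  ultimately show "p \<in> topspace (mtop (thick F))" by (auto simp: mtop_thick mem_Times_iff)
qed

text \<open>The coordinate expression of \<open>f\<close> near \<open>x\<close> is a continuous injection between Euclidean spaces of the
  same dimension, hence open by invariance of domain. Pulled back along the chart of \<open>F2\<close>, its image
  is an open neighbourhood of \<open>f x\<close> that consists of values of \<open>f\<close>.\<close>

lemma embedding_image_of_interior_point:
  fixes F1 :: "('a, 'e::euclidean_space \<times> real) smooth_space"
    and F2 :: "('b, 'e \<times> real) smooth_space"
  assumes F1: "smooth_manifold half_space F1" and F2: "smooth_manifold half_space F2"
    and emb: "embedding_map (mtop F1) (mtop F2) f"
    and U: "(U, \<phi>) \<in> atlas F1" "x \<in> U" "\<phi> x \<in> interior half_space"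
  shows "f x \<in> mtop F2 interior_of (f ` topspace (mtop F1))"
proof -
  note chU = chart_properties[OF F1 U(1)]
  have Usub: "U \<subseteq> topspace (mtop F1)" using chU(1) by (rule openin_subset)
  have f: "continuous_map (mtop F1) (mtop F2) f" and finj: "inj_on f (topspace (mtop F1))"
    using emb by (auto simp: embedding_map_def dest: homeomorphic_imp_continuous_map
        continuous_map_into_fulltopology homeomorphic_imp_injective_map)
  have "f x \<in> topspace (mtop F2)" using f U Usub by (auto simp: continuous_map_def Pi_iff)
  then obtain V \<psi> where V: "(V, \<psi>) \<in> atlas F2" "f x \<in> V"
    using F2 unfolding smooth_manifold_def by blast
  note chV = chart_properties[OF F2 V(1)]
  have Vsub: "V \<subseteq> topspace (mtop F2)" using chV(1) by (rule openin_subset)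
  define \<phi>' where "\<phi>' = inv_into U \<phi>"
  have \<phi>': "\<phi>' (\<phi> y) = y" if "y \<in> U" for y
    using that chU(3) by (simp add: \<phi>'_def)
  have \<phi>'cont: "continuous_map (top_of_set (\<phi> ` U)) (mtop F1) \<phi>'"
    using chU(4) unfolding homeomorphic_maps_def \<phi>'_def by (auto intro: continuous_map_into_fulltopology)
  define Q where "Q = \<phi> ` U \<inter> interior half_space"
  obtain T where "open T" "\<phi> ` U = half_space \<inter> T" using chU(2) by (auto simp: openin_open)
  then have "Q = T \<inter> interior half_space" using interior_subset by (auto simp: Q_def)
  then have "open Q" using \<open>open T\<close> by (simp add: open_Int)
  have fQ: "continuous_map (top_of_set Q) (mtop F2) (f \<circ> \<phi>')"
    using continuous_map_from_subtopology_mono[OF \<phi>'cont, of Q] f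
    by (auto simp: Q_def intro: continuous_map_compose)
  define W where "W = {z \<in> Q. (f \<circ> \<phi>') z \<in> V}"
  have "openin (top_of_set Q) W"
    using openin_continuous_map_preimage[OF fQ chV(1)] by (simp add: W_def)
  then have "open W" using \<open>open Q\<close> openin_open_trans by blast
  define h where "h = \<psi> \<circ> (f \<circ> \<phi>')"
  have WV: "(f \<circ> \<phi>') ` W \<subseteq> V" by (auto simp: W_def)
  have "continuous_map (top_of_set W) (subtopology (mtop F2) V) (f \<circ> \<phi>')"
    using continuous_map_from_subtopology_mono[OF fQ, of W] WV
    by (intro continuous_map_into_subtopology) (auto simp: W_def)
  moreover have "continuous_map (subtopology (mtop F2) V) (top_of_set (\<psi> ` V)) \<psi>"
    using chV(4) by (simp add: homeomorphic_maps_def)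
  ultimately have "continuous_map (top_of_set W) (top_of_set (\<psi> ` V)) h"
    unfolding h_def by (rule continuous_map_compose)
  then have "continuous_on W h" by (simp add: continuous_map_in_subtopology)
  moreover have "inj_on h W"
  proof (rule inj_onI)
    fix y z assume "y \<in> W" "z \<in> W" "h y = h z"
    then have "f (\<phi>' y) = f (\<phi>' z)"
      using chV(3) by (auto simp: h_def W_def inj_on_def)
    moreover obtain y' z' where "y = \<phi> y'" "y' \<in> U" "z = \<phi> z'" "z' \<in> U"
      using \<open>y \<in> W\<close> \<open>z \<in> W\<close> by (auto simp: W_def Q_def)
    ultimately show "y = z" using \<phi>' finj Usub by (metis inj_onD subsetD)
  qed
  ultimately have "open (h ` W)" using \<open>open W\<close> invariance_of_domain by blast
  then have "openin (top_of_set (\<psi> ` V)) (h ` W)"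
    using WV by (intro open_subset) (auto simp: h_def)
  then have "openin (subtopology (mtop F2) V) {y \<in> topspace (subtopology (mtop F2) V). \<psi> y \<in> h ` W}"
    using chV(4) by (intro openin_continuous_map_preimage) (auto simp: homeomorphic_maps_def)
  moreover have "{y \<in> topspace (subtopology (mtop F2) V). \<psi> y \<in> h ` W} = {y \<in> V. \<psi> y \<in> h ` W}"
    using Vsub by auto
  ultimately have op: "openin (mtop F2) {y \<in> V. \<psi> y \<in> h ` W}"
    using chV(1) openin_trans_full by metis
  moreover have "{y \<in> V. \<psi> y \<in> h ` W} \<subseteq> f ` topspace (mtop F1)"
  proof
    fix y assume "y \<in> {y \<in> V. \<psi> y \<in> h ` W}"
    then obtain z where z: "y \<in> V" "z \<in> W" "\<psi> y = \<psi> (f (\<phi>' z))" by (auto simp: h_def)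
    then have "y = f (\<phi>' z)" using chV(3) WV by (auto simp: inj_on_def)
    moreover have "\<phi>' z \<in> topspace (mtop F1)" using z(2) \<phi>' Usub by (auto simp: W_def Q_def)
    ultimately show "y \<in> f ` topspace (mtop F1)" by blast
  qed
  moreover have "f x \<in> {y \<in> V. \<psi> y \<in> h ` W}"
    using U V \<phi>' by (auto simp: W_def Q_def h_def intro!: image_eqI[of _ _ "\<phi> x"])
  ultimately show ?thesis unfolding interior_of_def by blast
qed

lemma embedded_link_facts:
  fixes F :: "('a, (real^'n) \<times> real) smooth_space"
  assumes F: "compact_manifold_bd F" and L: "embedded_link F L"
  shows "L \<subseteq> topspace (mtop (thick F))" "\<And>q. q \<in> L \<Longrightarrow> snd q < 1" "closedin (mtop F) (fst ` L)"
proof -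
  have mF: "smooth_manifold half_space F" "Hausdorff_space (mtop F)"
    using F by (auto simp: compact_manifold_bd_def smooth_manifold_def)
  have Li: "L \<subseteq> thick_interior F" using L by (simp add: embedded_link_def)
  then show "L \<subseteq> topspace (mtop (thick F))" using thick_interior_subset[OF mF(1)] by blast
  show "\<And>q. q \<in> L \<Longrightarrow> snd q < 1" using Li by (auto simp: thick_interior_iff)
  obtain N :: "('a \<times> real, real^'n) smooth_space" where N: "closed_manifold N" "topspace (mtop N) = L"
    "smooth_embedding N (thick F) id"
    using L unfolding embedded_link_def by blast
  have "compact_space (mtop N)" using N(1) by (simp add: closed_manifold_def)
  moreover have "continuous_map (mtop N) (mtop (thick F)) id"
    using N(3) unfolding smooth_embedding_def smooth_immersion_def smooth_map_def by blast
  moreover note N(2)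
  ultimately have "compactin (mtop (thick F)) L"
    using image_compactin[of "mtop N" L _ id] by (auto simp: compact_space_def)
  then have "compactin (mtop F) (fst ` L)"
    by (rule image_compactin) (simp add: mtop_thick continuous_map_fst)
  then show "closedin (mtop F) (fst ` L)" using mF(2) by (simp add: compactin_imp_closedin)
qed

text \<open>If the first base is empty, there is no cone point to collapse to; then both links are empty, and
  since every component meets the link, the second base is empty as well.\<close>

lemma embedding_related_homotopy_equivalent:
  fixes F1 F2 :: "('a, (real^'n) \<times> real) smooth_space"
  assumes p: "(F1, L1) \<in> thick_links" and q: "(F2, L2) \<in> thick_links"
    and rel: "embedding_related (F1, L1) (F2, L2)"
  shows "hcomplement F1 L1 homotopy_equivalent_space hcomplement F2 L2"
proof -
  have F: "compact_manifold_bd F1" "compact_manifold_bd F2"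
    and L: "embedded_link F1 L1" "embedded_link F2 L2"
    and meets: "\<And>C. C \<in> connected_components_of (mtop (thick F2)) \<Longrightarrow> C \<inter> L2 \<noteq> {}"
    using p q by (auto simp: thick_links_def)
  obtain f where f: "smooth_embedding F1 F2 f" and L2: "L2 = map_prod f id ` L1"
    using rel by auto
  have emb: "embedding_map (mtop F1) (mtop F2) f" using f by (simp add: smooth_embedding_def)
  have mF: "smooth_manifold half_space F1" "smooth_manifold half_space F2" "Hausdorff_space (mtop F2)"
    "compact_space (mtop F1)" "compact_space (mtop F2)"
    using F by (auto simp: compact_manifold_bd_def smooth_manifold_def)
  note l1 = embedded_link_facts[OF F(1) L(1)] and l2 = embedded_link_facts[OF F(2) L(2)]
  show ?thesis
  proof (cases "topspace (mtop F1) = {}")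
    case True
    then have "L1 = {}" using l1(1) by (auto simp: mtop_thick)
    then have "L2 = {}" using L2 by simp
    have "topspace (mtop (thick F2)) = {}"
      using meets \<open>L2 = {}\<close> Union_connected_components_of[of "mtop (thick F2)"] by blast
    moreover have "topspace (mtop (thick F1)) = {}" using True by (simp add: mtop_thick)
    ultimately have "topspace (hcomplement F1 L1) = {}" "topspace (hcomplement F2 L2) = {}"
      by (auto simp: hcomplement_def topspace_hspace)
    then have "hcomplement F1 L1 homeomorphic_space hcomplement F2 L2"
      by (simp add: homeomorphic_empty_space_eq null_topspace_iff_trivial)
    then show ?thesis by (rule homeomorphic_imp_homotopy_equivalent_space)
  next
    case False
    then obtain x0 where x0: "x0 \<in> topspace (mtop F1)" by blast
    have "fst ` L2 \<subseteq> mtop F2 interior_of (f ` topspace (mtop F1))"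
    proof
      fix y assume "y \<in> fst ` L2"
      then obtain p where p: "p \<in> L1" "y = f (fst p)" by (auto simp: L2)
      then have "p \<in> thick_interior F1" using L(1) by (auto simp: embedded_link_def)
      then obtain U \<phi> where "(U, \<phi>) \<in> atlas F1" "fst p \<in> U" "\<phi> (fst p) \<in> interior half_space"
        by (auto simp: thick_interior_iff)
      from embedding_image_of_interior_point[OF mF(1,2) emb this] p(2)
      show "y \<in> mtop F2 interior_of (f ` topspace (mtop F1))" by simp
    qed
    then show ?thesis
      using codim0_embedding_hcomplement_homotopy_equivalent[OF mF(5,3,4) emb l1(1,2) L2 l2(3) _ x0]
      by blast
  qed
qed

section \<open>Moving a link inside one chart\<close>

text \<open>The closed coordinate ball is compact, hence closed in the Hausdorff space \<open>X\<close>. Therefore the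
  homeomorphism in the chart can be pasted with the identity along the coordinate sphere.\<close>

lemma chart_supported_homeomorphism:
  fixes X :: "'a topology" and \<psi> :: "'a \<Rightarrow> 'b::euclidean_space"
  assumes X: "Hausdorff_space X" and V: "openin X V"
    and \<psi>: "homeomorphic_maps (subtopology X V) (top_of_set (\<psi> ` V)) \<psi> \<psi>'"
    and R: "cball b R \<subseteq> \<psi> ` V"
    and fg: "homeomorphism UNIV UNIV f g" and supp: "\<And>x. x \<notin> ball b R \<Longrightarrow> f x = x"
  obtains f' g' where "homeomorphic_maps X X f' g'"
    "\<And>q. q \<in> V \<Longrightarrow> \<psi> q \<in> ball b R \<Longrightarrow> f' q = \<psi>' (f (\<psi> q))"
    "\<And>q. \<not> (q \<in> V \<and> \<psi> q \<in> ball b R) \<Longrightarrow> f' q = q"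
proof -
  have Vsub: "V \<subseteq> topspace X" using V by (rule openin_subset)
  have \<psi>V: "\<psi>' (\<psi> q) = q" if "q \<in> V" for q
    using \<psi> that Vsub by (auto simp: homeomorphic_maps_def)
  have \<psi>': "\<psi>' y \<in> V" "\<psi> (\<psi>' y) = y" if "y \<in> \<psi> ` V" for y
    using that \<psi>V by auto
  have \<psi>c: "continuous_map (subtopology X V) (top_of_set (\<psi> ` V)) \<psi>"
    and \<psi>'c: "continuous_map (top_of_set (\<psi> ` V)) X \<psi>'"
    using \<psi> by (auto simp: homeomorphic_maps_def intro: continuous_map_into_fulltopology)
  define B where "B = {q \<in> V. \<psi> q \<in> ball b R}"
  define C where "C = {q \<in> V. \<psi> q \<in> cball b R}"
  have "openin (top_of_set (\<psi> ` V)) (ball b R)"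
    using R ball_subset_cball by (intro open_subset) auto
  then have "openin (subtopology X V) {q \<in> topspace (subtopology X V). \<psi> q \<in> ball b R}"
    by (rule openin_continuous_map_preimage[OF \<psi>c])
  moreover have "{q \<in> topspace (subtopology X V). \<psi> q \<in> ball b R} = B" using Vsub by (auto simp: B_def)
  ultimately have Bop: "openin X B" using V openin_trans_full by metis
  have "C = \<psi>' ` cball b R"
  proof (intro equalityI subsetI)
    fix q assume "q \<in> C"
    then show "q \<in> \<psi>' ` cball b R" using \<psi>V[of q] by (auto simp: C_def intro!: image_eqI[of q \<psi>' "\<psi> q"])
  next
    fix q assume "q \<in> \<psi>' ` cball b R"
    then obtain y where "y \<in> cball b R" "q = \<psi>' y" by blast
    then show "q \<in> C" using \<psi>'[of y] R by (auto simp: C_def)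
  qed
  moreover have "compactin X (\<psi>' ` cball b R)"
    by (rule image_compactin[OF _ \<psi>'c]) (use R in \<open>simp add: compactin_subtopology\<close>)
  ultimately have Ccl: "closedin X C" using X by (simp add: compactin_imp_closedin)
  define E where "E h q = (if q \<in> B then \<psi>' (h (\<psi> q)) else q)" for h q
  have E_cont: "continuous_map X X (E h)"
    if h: "continuous_on UNIV h" "\<And>x. x \<notin> ball b R \<Longrightarrow> h x = x" "h ` cball b R \<subseteq> cball b R" for h
  proof (rule pasting_lemma_closed[where I = "{True, False}" and T = "\<lambda>j. if j then C else topspace X - B"
        and f = "\<lambda>j q. if j then \<psi>' (h (\<psi> q)) else q"])
    fix j :: bool
    show "closedin X (if j then C else topspace X - B)" using Ccl Bop by auto
    show "continuous_map (subtopology X (if j then C else topspace X - B)) X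
        (\<lambda>q. if j then \<psi>' (h (\<psi> q)) else q)"
    proof (cases j)
      case True
      have "continuous_map (subtopology X C) (top_of_set (cball b R)) \<psi>"
        using continuous_map_from_subtopology_mono[OF \<psi>c[unfolded continuous_map_in_subtopology, THEN conjunct1], of C]
        using continuous_map_from_subtopology[OF \<psi>c, of C]
        by (auto simp: continuous_map_in_subtopology subtopology_subtopology C_def Int_absorb1)
      moreover have "continuous_map (top_of_set (cball b R)) (top_of_set (\<psi> ` V)) h"
        using h R by (auto simp: continuous_map_in_subtopology intro: continuous_on_subset)
      ultimately have "continuous_map (subtopology X C) X (\<psi>' \<circ> (h \<circ> \<psi>))"
        using \<psi>'c by (meson continuous_map_compose)
      then show ?thesis using True by (simp add: o_def)
    next
      case False
      then show ?thesis using continuous_map_from_subtopology[OF continuous_map_id] by (simp add: id_def)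
    qed
  next
    fix i j q assume "q \<in> topspace X \<inter> (if i then C else topspace X - B) \<inter> (if j then C else topspace X - B)"
    then show "(if i then \<psi>' (h (\<psi> q)) else q) = (if j then \<psi>' (h (\<psi> q)) else q)"
      using h(2)[of "\<psi> q"] \<psi>V by (auto simp: B_def C_def split: if_splits)
  next
    fix q assume "q \<in> topspace X"
    then show "\<exists>j. j \<in> {True, False} \<and> q \<in> (if j then C else topspace X - B)
        \<and> E h q = (if j then \<psi>' (h (\<psi> q)) else q)"
      by (intro exI[of _ "q \<in> B"]) (auto simp: B_def C_def E_def)
  qed simp
  have gf: "\<And>x. g (f x) = x" "\<And>x. f (g x) = x" and cont: "continuous_on UNIV f" "continuous_on UNIV g"
    using fg by (auto simp: homeomorphism_def)
  have suppg: "g x = x" if "x \<notin> ball b R" for x using supp[OF that] gf by metis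
  have fB: "f x \<in> ball b R" if "x \<in> ball b R" for x using that supp gf by metis
  have gB: "g x \<in> ball b R" if "x \<in> ball b R" for x using that suppg gf by metis
  have fC: "f ` cball b R \<subseteq> cball b R" "g ` cball b R \<subseteq> cball b R"
  proof -
    have *: "h ` cball b R \<subseteq> cball b R"
      if "\<And>x. x \<in> ball b R \<Longrightarrow> h x \<in> ball b R" "\<And>x. x \<notin> ball b R \<Longrightarrow> h x = x" for h
    proof (rule image_subsetI)
      fix x assume "x \<in> cball b R"
      then show "h x \<in> cball b R"
        using that[of x] ball_subset_cball[of b R] by (cases "x \<in> ball b R") auto
    qed
    show "f ` cball b R \<subseteq> cball b R" by (rule *[OF fB supp])
    show "g ` cball b R \<subseteq> cball b R" by (rule *[OF gB suppg])
  qed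
  have inv: "E g (E f q) = q" "E f (E g q) = q" for q
  proof -
    have *: "E g (E f q) = q" if "\<And>x. x \<in> ball b R \<Longrightarrow> f x \<in> ball b R" "\<And>x. g (f x) = x" for f g q
    proof (cases "q \<in> B")
      case True
      then have "f (\<psi> q) \<in> ball b R" using that by (auto simp: B_def)
      moreover from this have "f (\<psi> q) \<in> \<psi> ` V" using R ball_subset_cball by blast
      ultimately have "f (\<psi> q) \<in> \<psi> ` V" "f (\<psi> q) \<in> ball b R" by simp_all
      then show ?thesis using True \<psi>' \<psi>V that by (auto simp: E_def B_def)
    qed (simp add: E_def)
    show "E g (E f q) = q" "E f (E g q) = q" using * fB gB gf by blast+
  qed
  have "homeomorphic_maps X X (E f) (E g)"
    unfolding homeomorphic_maps_def
    using E_cont[OF cont(1) supp fC(1)] E_cont[OF cont(2) suppg fC(2)] inv by auto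
  then show ?thesis
    by (rule that) (auto simp: E_def B_def)
qed

text \<open>Here \<open>e (u, t)\<close> is the coordinate expression of an isotopy, and \<open>s\<close>, \<open>t\<close> are the values of two
  time functions with small Lipschitz constant \<open>\<kappa>\<close>. Up to an error that is small compared with the
  distance of \<open>u\<close> and \<open>u'\<close>, both \<open>e (u, s) - e (u', s')\<close> and \<open>e (u, t) - e (u', t')\<close> equal
  \<open>D (u - u', 0)\<close>, whose norm is at least \<open>c * norm (u - u')\<close> by injectivity. So their difference is
  small relative to either of them: the displacement from \<open>e (u, s)\<close> to \<open>e (u, t)\<close> is a function
  with small Lipschitz constant of the point \<open>e (u, s)\<close>.\<close>

lemma nearly_constant_time_displacement:
  fixes e :: "'u::euclidean_space \<times> real \<Rightarrow> 'b::euclidean_space"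
  assumes D: "bounded_linear D" and inj: "inj (\<lambda>v. D (v, 0))" and k: "0 < k" "k \<le> 1"
    and strict: "\<And>\<eta>. \<eta> > 0 \<Longrightarrow> \<exists>r>0. \<forall>y\<in>S \<inter> ball z r. \<forall>y'\<in>S \<inter> ball z r.
        norm (e y - e y' - D (y - y')) \<le> \<eta> * norm (y - y')"
  obtains \<kappa> \<rho> C where "\<kappa> > 0" "\<rho> > 0" "C > 0"
    "\<And>y y'. y \<in> S \<inter> ball z \<rho> \<Longrightarrow> y' \<in> S \<inter> ball z \<rho> \<Longrightarrow> norm (e y - e y') \<le> C * norm (y - y')"
    "\<And>u u' s s'. (u, s) \<in> S \<inter> ball z \<rho> \<Longrightarrow> (u', s') \<in> S \<inter> ball z \<rho> \<Longrightarrow>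
       \<bar>s - s'\<bar> \<le> \<kappa> * norm (u - u') \<Longrightarrow> e (u, s) = e (u', s') \<Longrightarrow> u = u'"
    "\<And>u u' s s' t t'. (u, s) \<in> S \<inter> ball z \<rho> \<Longrightarrow> (u', s') \<in> S \<inter> ball z \<rho> \<Longrightarrow>
       (u, t) \<in> S \<inter> ball z \<rho> \<Longrightarrow> (u', t') \<in> S \<inter> ball z \<rho> \<Longrightarrow>
       \<bar>s - s'\<bar> \<le> \<kappa> * norm (u - u') \<Longrightarrow> \<bar>t - t'\<bar> \<le> \<kappa> * norm (u - u') \<Longrightarrow>
       norm ((e (u, t) - e (u, s)) - (e (u', t') - e (u', s'))) \<le> k * norm (e (u, s) - e (u', s'))"
proof -
  interpret D: bounded_linear D by (rule D)
  have lin: "linear (\<lambda>v. D (v, 0))"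
    by (rule bounded_linear.linear[OF bounded_linear_compose[OF D]])
      (intro bounded_linear_Pair bounded_linear_ident bounded_linear_zero)
  obtain c where c: "c > 0" "\<And>v. c * norm v \<le> norm (D (v, 0))"
    using linear_inj_bounded_below_pos[OF lin inj] by (metis mult.commute)
  obtain M where M: "M > 0" "\<And>y. norm (D y) \<le> M * norm y"
    using D.pos_bounded by (metis mult.commute)
  \<comment> \<open>chosen so that the total error \<open>M * \<kappa> + \<eta> * (1 + \<kappa>)\<close> is at most \<open>k * c / 4\<close>\<close>
  define \<eta> where "\<eta> = k * c / 16"
  define \<kappa> where "\<kappa> = min 1 (k * c / (8 * M))"
  have pos: "\<eta> > 0" "\<kappa> > 0" "\<kappa> \<le> 1" using k c M by (auto simp: \<eta>_def \<kappa>_def)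
  have "M * \<kappa> \<le> M * (k * c / (8 * M))" using M by (intro mult_left_mono) (auto simp: \<kappa>_def)
  also have "\<dots> = k * c / 8" using M by simp
  finally have "M * \<kappa> + \<eta> * (1 + \<kappa>) \<le> k * c / 8 + \<eta> * 2"
    using pos by (intro add_mono mult_left_mono) auto
  then have const: "M * \<kappa> + \<eta> * (1 + \<kappa>) \<le> k * c / 4"
    unfolding \<eta>_def by linarith
  obtain \<rho> where "\<rho> > 0" and \<rho>: "\<And>y y'. y \<in> S \<inter> ball z \<rho> \<Longrightarrow> y' \<in> S \<inter> ball z \<rho> \<Longrightarrow>
        norm (e y - e y' - D (y - y')) \<le> \<eta> * norm (y - y')"
    using strict[OF pos(1)] by blast
  have err: "norm (e (u, s) - e (u', s') - D (u - u', s - s')) \<le> \<eta> * (1 + \<kappa>) * norm (u - u')"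
    if "(u, s) \<in> S \<inter> ball z \<rho>" "(u', s') \<in> S \<inter> ball z \<rho>" "\<bar>s - s'\<bar> \<le> \<kappa> * norm (u - u')" for u u' s s'
  proof -
    have "norm (u - u', s - s') \<le> (1 + \<kappa>) * norm (u - u')"
      using norm_Pair_le[of "u - u'" "s - s'"] that(3) by (simp add: algebra_simps)
    then have "\<eta> * norm (u - u', s - s') \<le> \<eta> * ((1 + \<kappa>) * norm (u - u'))"
      using pos by (intro mult_left_mono) auto
    with \<rho>[OF that(1,2)] show ?thesis by (simp add: mult.assoc)
  qed
  have time: "norm (D (0, s - s')) \<le> M * \<kappa> * norm (u - u')" if "\<bar>s - s'\<bar> \<le> \<kappa> * norm (u - u')" for u u' :: 'u and s s'
  proof -
    have "norm (D (0, s - s')) \<le> M * \<bar>s - s'\<bar>" using M(2)[of "(0, s - s')"] by simp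
    also have "\<dots> \<le> M * (\<kappa> * norm (u - u'))" using that M by (intro mult_left_mono) auto
    finally show ?thesis by (simp add: mult.assoc)
  qed
  have split: "D (v, s) = D (v, 0) + D (0, s)" for v s
    using D.add[of "(v, 0)" "(0, s)"] by simp
  have lower: "c / 2 * norm (u - u') \<le> norm (e (u, s) - e (u', s'))"
    if "(u, s) \<in> S \<inter> ball z \<rho>" "(u', s') \<in> S \<inter> ball z \<rho>" "\<bar>s - s'\<bar> \<le> \<kappa> * norm (u - u')" for u u' s s'
  proof -
    have "D (u - u', 0) = (e (u, s) - e (u', s')) - (e (u, s) - e (u', s') - D (u - u', s - s')) - D (0, s - s')"
      by (simp add: split[of "u - u'" "s - s'"])
    then have "norm (D (u - u', 0)) \<le> norm (e (u, s) - e (u', s'))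
        + norm (e (u, s) - e (u', s') - D (u - u', s - s')) + norm (D (0, s - s'))"
      by (metis (no_types) norm_triangle_ineq4 add_right_mono order_trans)
    with c(2)[of "u - u'"] err[OF that] time[OF that(3)]
    have "c * norm (u - u') \<le> norm (e (u, s) - e (u', s')) + (M * \<kappa> + \<eta> * (1 + \<kappa>)) * norm (u - u')"
      by (simp add: algebra_simps)
    moreover have "(M * \<kappa> + \<eta> * (1 + \<kappa>)) * norm (u - u') \<le> c / 2 * norm (u - u')"
    proof (rule mult_right_mono)
      have "k * c \<le> c" using k c by simp
      then show "M * \<kappa> + \<eta> * (1 + \<kappa>) \<le> c / 2" using const c(1) by linarith
    qed simp
    ultimately show ?thesis by simp
  qed
  show ?thesis
  proof
    show "\<kappa> > 0" "\<rho> > 0" "M + \<eta> > 0" using pos \<open>\<rho> > 0\<close> M by auto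
    show "norm (e y - e y') \<le> (M + \<eta>) * norm (y - y')"
      if "y \<in> S \<inter> ball z \<rho>" "y' \<in> S \<inter> ball z \<rho>" for y y'
      using norm_triangle_ineq[of "e y - e y' - D (y - y')" "D (y - y')"] \<rho>[OF that] M(2)[of "y - y'"]
      by (simp add: algebra_simps)
    show "u = u'" if "(u, s) \<in> S \<inter> ball z \<rho>" "(u', s') \<in> S \<inter> ball z \<rho>"
      "\<bar>s - s'\<bar> \<le> \<kappa> * norm (u - u')" "e (u, s) = e (u', s')" for u u' s s'
      using lower[OF that(1-3)] that(4) c(1) by (simp add: mult_le_0_iff)
    show "norm ((e (u, t) - e (u, s)) - (e (u', t') - e (u', s'))) \<le> k * norm (e (u, s) - e (u', s'))"
      if *: "(u, s) \<in> S \<inter> ball z \<rho>" "(u', s') \<in> S \<inter> ball z \<rho>"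
        "(u, t) \<in> S \<inter> ball z \<rho>" "(u', t') \<in> S \<inter> ball z \<rho>"
        "\<bar>s - s'\<bar> \<le> \<kappa> * norm (u - u')" "\<bar>t - t'\<bar> \<le> \<kappa> * norm (u - u')" for u u' s s' t t'
    proof -
      define x y where "x = e (u, t) - e (u', t') - D (u - u', t - t')"
        and "y = e (u, s) - e (u', s') - D (u - u', s - s')"
      have "(e (u, t) - e (u, s)) - (e (u', t') - e (u', s')) = (x + D (0, t - t')) - (y + D (0, s - s'))"
        by (simp add: x_def y_def split[of "u - u'" "t - t'"] split[of "u - u'" "s - s'"])
      then have "norm ((e (u, t) - e (u, s)) - (e (u', t') - e (u', s')))
          \<le> (norm x + norm (D (0, t - t'))) + (norm y + norm (D (0, s - s')))"
        using norm_triangle_ineq4[of "x + D (0, t - t')" "y + D (0, s - s')"]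
          norm_triangle_ineq[of x "D (0, t - t')"] norm_triangle_ineq[of y "D (0, s - s')"] by simp
      also have "\<dots> \<le> (\<eta> * (1 + \<kappa>) * norm (u - u') + M * \<kappa> * norm (u - u'))
          + (\<eta> * (1 + \<kappa>) * norm (u - u') + M * \<kappa> * norm (u - u'))"
        unfolding x_def y_def by (intro add_mono err time *)
      also have "\<dots> = 2 * (M * \<kappa> + \<eta> * (1 + \<kappa>)) * norm (u - u')" by (simp add: algebra_simps)
      also have "\<dots> \<le> (k * (c / 2)) * norm (u - u')"
        using const by (intro mult_right_mono) auto
      also have "\<dots> = k * (c / 2 * norm (u - u'))" by simp
      also have "\<dots> \<le> k * norm (e (u, s) - e (u', s'))"
        using k lower[OF *(1,2,5)] by (intro mult_left_mono) auto
      finally show ?thesis .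
    qed
  qed
qed

lemma thick_chart:
  fixes F :: "('a, 'e::euclidean_space \<times> real) smooth_space"
  assumes F: "smooth_manifold half_space F" and V: "(V, \<psi>) \<in> atlas F"
  shows "openin (mtop (thick F)) (V \<times> {0..1})"
    "openin (top_of_set (half_space \<times> {0..1::real})) (map_prod \<psi> id ` (V \<times> {0..1}))"
    "homeomorphic_maps (subtopology (mtop (thick F)) (V \<times> {0..1})) (top_of_set (map_prod \<psi> id ` (V \<times> {0..1})))
       (map_prod \<psi> id) (map_prod (inv_into V \<psi>) id)"
proof -
  note ch = chart_properties[OF F V]
  have im: "map_prod \<psi> id ` (V \<times> {0..1}) = (\<psi> ` V) \<times> {0..1::real}"
    by (auto simp: image_iff)
  show "openin (mtop (thick F)) (V \<times> {0..1})"
    using ch(1) by (simp add: mtop_thick openin_prod_Times_iff)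
  have "openin (prod_topology (top_of_set half_space) (top_of_set {0..1::real})) ((\<psi> ` V) \<times> {0..1})"
    using ch(2) by (simp add: openin_prod_Times_iff del: prod_topology_subtopology_eu)
  then show "openin (top_of_set (half_space \<times> {0..1::real})) (map_prod \<psi> id ` (V \<times> {0..1}))"
    unfolding im by simp
  have "homeomorphic_maps (prod_topology (subtopology (mtop F) V) (top_of_set {0..1::real}))
      (prod_topology (top_of_set (\<psi> ` V)) (top_of_set {0..1}))
      (\<lambda>(x, y). (\<psi> x, id y)) (\<lambda>(x, y). (inv_into V \<psi> x, id y))"
    unfolding homeomorphic_maps_prod using ch(4) homeomorphic_maps_id by blast
  then show "homeomorphic_maps (subtopology (mtop (thick F)) (V \<times> {0..1})) (top_of_set (map_prod \<psi> id ` (V \<times> {0..1})))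
       (map_prod \<psi> id) (map_prod (inv_into V \<psi>) id)"
    unfolding im by (simp add: mtop_thick subtopology_Times subtopology_subtopology map_prod_def)
qed

text \<open>This identifies the restriction of \<open>D\<close> to the directions of space with the derivative of the map at
  time \<open>t\<close>, which is injective when that map is an immersion.\<close>

lemma has_derivative_slice:
  fixes e :: "'u::euclidean_space \<times> real \<Rightarrow> 'b::euclidean_space"
  assumes D: "bounded_linear D" and a: "r0 > 0" "\<And>u. u \<in> ball a r0 \<Longrightarrow> (u, t) \<in> S"
    and strict: "\<And>\<eta>. \<eta> > 0 \<Longrightarrow> \<exists>r>0. \<forall>y\<in>S \<inter> ball (a, t) r. \<forall>y'\<in>S \<inter> ball (a, t) r.
        norm (e y - e y' - D (y - y')) \<le> \<eta> * norm (y - y')"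
  shows "((\<lambda>u. e (u, t)) has_derivative (\<lambda>v. D (v, 0))) (at a)"
  unfolding has_derivative_at_alt
proof (intro conjI allI impI)
  show "bounded_linear (\<lambda>v. D (v, 0))"
    by (rule bounded_linear_compose[OF D])
      (intro bounded_linear_Pair bounded_linear_ident bounded_linear_zero)
  fix \<eta> :: real assume "0 < \<eta>"
  from strict[OF this] obtain r where "r > 0" and r: "\<And>y y'. y \<in> S \<inter> ball (a, t) r \<Longrightarrow>
      y' \<in> S \<inter> ball (a, t) r \<Longrightarrow> norm (e y - e y' - D (y - y')) \<le> \<eta> * norm (y - y')" by blast
  show "\<exists>d>0. \<forall>y. norm (y - a) < d \<longrightarrow> norm (e (y, t) - e (a, t) - D (y - a, 0)) \<le> \<eta> * norm (y - a)"
  proof (intro exI[of _ "min r r0"] conjI allI impI)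
    fix y assume y: "norm (y - a) < min r r0"
    then have "(y, t) \<in> S \<inter> ball (a, t) r" "(a, t) \<in> S \<inter> ball (a, t) r"
      using a \<open>r > 0\<close> by (auto simp: dist_Pair_Pair dist_norm norm_minus_commute)
    from r[OF this] show "norm (e (y, t) - e (a, t) - D (y - a, 0)) \<le> \<eta> * norm (y - a)"
      by (simp add: norm_Pair)
  qed (use a \<open>r > 0\<close> in auto)
qed

text \<open>At time \<open>t0\<close> the compact image of \<open>K\<close> misses \<open>q\<close>, so it misses a closed coordinate ball around \<open>q\<close>; by the
  tube lemma this persists for nearby times.\<close>

lemma isotopy_avoids_far_points:
  fixes \<psi> :: "'x \<Rightarrow> 'b::euclidean_space"
  assumes N: "compact_space N" and K: "closedin N K"
    and X: "Hausdorff_space X" and E: "continuous_map (prod_topology N (top_of_set {0..1::real})) X E"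
    and t0: "t0 \<in> {0..1}" and q: "q \<in> V" "q \<notin> (\<lambda>x. E (x, t0)) ` K"
    and V: "openin X V"
    and \<psi>: "homeomorphic_maps (subtopology X V) (top_of_set (\<psi> ` V)) \<psi> \<psi>'"
    and R0: "R0 > 0" "cball (\<psi> q) R0 \<subseteq> \<psi> ` V"
  obtains R \<delta> where "0 < R" "R \<le> R0" "0 < \<delta>"
    "\<And>x t. x \<in> K \<Longrightarrow> t \<in> {0..1} \<Longrightarrow> \<bar>t - t0\<bar> < \<delta> \<Longrightarrow> \<not> (E (x, t) \<in> V \<and> \<psi> (E (x, t)) \<in> cball (\<psi> q) R)"
proof -
  let ?I = "top_of_set {0..1::real}"
  have Vsub: "V \<subseteq> topspace X" using V by (rule openin_subset)
  have \<psi>V: "\<psi>' (\<psi> q) = q" if "q \<in> V" for q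
    using \<psi> that Vsub by (auto simp: homeomorphic_maps_def)
  have \<psi>'c: "continuous_map (top_of_set (\<psi> ` V)) X \<psi>'"
    using \<psi> by (auto simp: homeomorphic_maps_def intro: continuous_map_into_fulltopology)
  have Kc: "compactin N K" using N K by (rule closedin_compact_space)
  have Et: "continuous_map N X (\<lambda>x. E (x, t0))"
  proof -
    have "continuous_map N (prod_topology N ?I) (\<lambda>x. (x, t0))"
      using t0 by (simp add: continuous_map_paired)
    from continuous_map_compose[OF this E] show ?thesis by (simp add: o_def)
  qed
  have "closedin X ((\<lambda>x. E (x, t0)) ` K)"
    using image_compactin[OF Kc Et] X by (simp add: compactin_imp_closedin)
  then have "openin (top_of_set (\<psi> ` V)) {y \<in> topspace (top_of_set (\<psi> ` V)). \<psi>' y \<in> topspace X - (\<lambda>x. E (x, t0)) ` K}"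
    by (intro openin_continuous_map_preimage[OF \<psi>'c]) auto
  moreover have "\<psi> q \<in> {y \<in> topspace (top_of_set (\<psi> ` V)). \<psi>' y \<in> topspace X - (\<lambda>x. E (x, t0)) ` K}"
    using q \<psi>V Vsub by auto
  ultimately obtain R1 where R1: "R1 > 0"
    "cball (\<psi> q) R1 \<inter> \<psi> ` V \<subseteq> {y \<in> topspace (top_of_set (\<psi> ` V)). \<psi>' y \<in> topspace X - (\<lambda>x. E (x, t0)) ` K}"
    unfolding openin_contains_cball by blast
  define R where "R = min R0 R1"
  have R: "0 < R" "R \<le> R0" "R \<le> R1" using R0 R1 by (auto simp: R_def)
  define C where "C = \<psi>' ` cball (\<psi> q) R"
  have "compactin X C"
    unfolding C_def
    by (rule image_compactin[OF _ \<psi>'c]) (use R R0 in \<open>auto simp: compactin_subtopology\<close>)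
  then have "closedin X C" using X by (simp add: compactin_imp_closedin)
  have inC: "y \<in> C" if "y \<in> V" "\<psi> y \<in> cball (\<psi> q) R" for y
    using that \<psi>V[of y] unfolding C_def by (intro image_eqI[of _ _ "\<psi> y"]) auto
  define W where "W = {z \<in> topspace (prod_topology N ?I). E z \<in> topspace X - C}"
  have "openin (prod_topology N ?I) W"
    unfolding W_def using \<open>closedin X C\<close> by (intro openin_continuous_map_preimage[OF E]) auto
  moreover have "K \<times> {t0} \<subseteq> W"
  proof (rule subsetI)
    fix z assume "z \<in> K \<times> {t0}"
    then obtain x where x: "x \<in> K" "z = (x, t0)" by auto
    have "x \<in> topspace N" using x(1) closedin_subset[OF K] by blast
    moreover have "E (x, t0) \<in> topspace X" using Et \<open>x \<in> topspace N\<close> by (auto simp: continuous_map_def Pi_iff)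
    moreover have "E (x, t0) \<notin> C"
    proof
      assume "E (x, t0) \<in> C"
      then obtain y where y: "y \<in> cball (\<psi> q) R" "E (x, t0) = \<psi>' y" by (auto simp: C_def)
      then have "y \<in> cball (\<psi> q) R1 \<inter> \<psi> ` V" using R R0 by auto
      then have "\<psi>' y \<notin> (\<lambda>x. E (x, t0)) ` K" using R1(2) by blast
      with y(2) x(1) show False by force
    qed
    ultimately show "z \<in> W" using t0 x(2) by (simp add: W_def)
  qed
  ultimately obtain A B where AB: "openin N A" "openin ?I B" "K \<subseteq> A" "t0 \<in> B" "A \<times> B \<subseteq> W"
    using tube_lemma_left[of N ?I W K t0] Kc t0 by auto
  obtain \<delta> where \<delta>: "\<delta> > 0" "ball t0 \<delta> \<inter> {0..1} \<subseteq> B"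
    using AB(2,4) unfolding openin_contains_ball by blast
  show ?thesis
  proof (rule that[of R \<delta>])
    fix x t assume x: "x \<in> K" "t \<in> {0..1}" "\<bar>t - t0\<bar> < \<delta>"
    then have "t \<in> B" using \<delta>(2) by (auto simp: dist_real_def)
    then have "(x, t) \<in> W" using AB(3,5) x(1) by blast
    then show "\<not> (E (x, t) \<in> V \<and> \<psi> (E (x, t)) \<in> cball (\<psi> q) R)"
      using inC unfolding W_def by blast
  qed (use R \<delta> in auto)
qed

locale link_isotopy =
  fixes F :: "('a, (real^'n) \<times> real) smooth_space" and N :: "('c, real^'n) smooth_space"
    and E :: "'c \<times> real \<Rightarrow> 'a \<times> real"
  assumes F: "compact_manifold_bd F" and N: "closed_manifold N"
    and smooth: "smooth_map (prod_manifold N unit_interval) (thick F) E"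
    and embed: "t \<in> {0..1} \<Longrightarrow> smooth_embedding N (thick F) (\<lambda>x. E (x, t))"
    and inside: "t \<in> {0..1} \<Longrightarrow> x \<in> topspace (mtop N) \<Longrightarrow> E (x, t) \<in> thick_interior F"
begin

text \<open>The link obtained by stopping every point \<open>x\<close> at its own time \<open>\<sigma> x\<close>; constant functions \<open>\<sigma>\<close> give the
  links of the isotopy.\<close>

abbreviation graph_link :: "('c \<Rightarrow> real) \<Rightarrow> ('a \<times> real) set" where
  "graph_link \<sigma> \<equiv> (\<lambda>x. E (x, \<sigma> x)) ` topspace (mtop N)"

lemma manifolds: "smooth_manifold half_space F" "Hausdorff_space (mtop F)" "Hausdorff_space (mtop (thick F))"
  "smooth_manifold UNIV N" "Hausdorff_space (mtop N)" "compact_space (mtop N)"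
  using F N by (auto simp: compact_manifold_bd_def closed_manifold_def smooth_manifold_def mtop_thick
      Hausdorff_space_prod_topology Hausdorff_space_subtopology)

lemma continuous_isotopy: "continuous_map (prod_topology (mtop N) (top_of_set {0..1})) (mtop (thick F)) E"
  using smooth by (simp add: smooth_map_def prod_manifold_def unit_interval_def)

text \<open>If two time functions are close to \<open>t0\<close>, have small Lipschitz constant in the chart around \<open>p\<close> and
  agree away from \<open>p\<close>, then the two links differ by a homeomorphism supported in a coordinate ball
  of the thickened manifold. The order of choices matters: first the radius \<open>r\<close>, on which the
  estimates in coordinates hold; then the radius \<open>R\<close> of the target ball, such that only points of the
  \<open>r\<close>-ball enter it; then \<open>r'\<close> and \<open>\<delta>\<close>, such that the points that move stay in the ball of half the
  radius and move by little.\<close>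

lemma local_move:
  assumes t0: "t0 \<in> {0..1}" and p: "p \<in> topspace (mtop N)"
  obtains U \<phi> r r' \<kappa> \<delta> where "(U, \<phi>) \<in> atlas N" "p \<in> U" "0 < r'" "r' \<le> r" "0 < \<kappa>" "0 < \<delta>"
    "cball (\<phi> p) r \<subseteq> \<phi> ` U"
    "\<And>\<sigma> \<tau>. \<lbrakk>\<And>x. x \<in> topspace (mtop N) \<Longrightarrow> \<sigma> x \<in> {0..1} \<and> \<bar>\<sigma> x - t0\<bar> < \<delta>;
      \<And>x. x \<in> topspace (mtop N) \<Longrightarrow> \<tau> x \<in> {0..1} \<and> \<bar>\<tau> x - t0\<bar> < \<delta>;
      \<kappa>-lipschitz_on (cball (\<phi> p) r) (\<sigma> \<circ> inv_into U \<phi>); \<kappa>-lipschitz_on (cball (\<phi> p) r) (\<tau> \<circ> inv_into U \<phi>);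
      \<And>x. x \<in> topspace (mtop N) \<Longrightarrow> \<sigma> x \<noteq> \<tau> x \<Longrightarrow> x \<in> U \<and> \<phi> x \<in> cball (\<phi> p) r'\<rbrakk>
      \<Longrightarrow> hcomplement F (graph_link \<sigma>) homeomorphic_space hcomplement F (graph_link \<tau>)"
proof -
  let ?X = "mtop (thick F)"
  obtain U \<phi> where U: "(U, \<phi>) \<in> atlas N" "p \<in> U"
    using manifolds(4) p unfolding smooth_manifold_def by blast
  note chU = chart_properties[OF manifolds(4) U(1)]
  define \<phi>' where "\<phi>' = inv_into U \<phi>"
  have Usub: "U \<subseteq> topspace (mtop N)" using chU(1) by (rule openin_subset)
  have \<phi>'\<phi>: "\<phi>' (\<phi> x) = x" if "x \<in> U" for x using that chU(3) by (simp add: \<phi>'_def)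
  have \<phi>': "\<phi>' u \<in> U" "\<phi> (\<phi>' u) = u" if "u \<in> \<phi> ` U" for u using that \<phi>'\<phi> by auto
  have \<phi>'c: "continuous_map (top_of_set (\<phi> ` U)) (mtop N) \<phi>'"
    using chU(4) by (auto simp: \<phi>'_def homeomorphic_maps_def intro: continuous_map_into_fulltopology)
  have "open (\<phi> ` U)" using chU(2) by simp
  define a where "a = \<phi> p"
  define q where "q = E (p, t0)"
  have "q \<in> thick_interior F" using inside t0 p by (simp add: q_def)
  then obtain V0 \<psi>0 where V0: "(V0, \<psi>0) \<in> atlas F" "fst q \<in> V0" "\<psi>0 (fst q) \<in> interior half_space"
    "0 < snd q" "snd q < 1" by (auto simp: thick_interior_iff)
  define V where "V = V0 \<times> {0..1::real}"
  define \<psi> :: "'a \<times> real \<Rightarrow> ((real^'n) \<times> real) \<times> real" where "\<psi> = map_prod \<psi>0 id"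
  define \<psi>' where "\<psi>' = map_prod (inv_into V0 \<psi>0) (id :: real \<Rightarrow> real)"
  note chV = thick_chart[OF manifolds(1) V0(1), folded V_def \<psi>_def \<psi>'_def]
  have Vatlas: "(V, \<psi>) \<in> atlas (thick F)" using V0(1) by (force simp: atlas_thick V_def \<psi>_def)
  have qV: "q \<in> V" using V0 by (simp add: V_def mem_Times_iff)
  have Vsub: "V \<subseteq> topspace ?X" using chV(1) by (rule openin_subset)
  have \<psi>'\<psi>: "\<psi>' (\<psi> y) = y" if "y \<in> V" for y
    using chV(3) that Vsub by (auto simp: homeomorphic_maps_def)
  \<comment> \<open>the ball has to avoid the top face, which the homeomorphism must fix to act on the cone\<close>
  obtain R0 where R0: "R0 > 0" "cball (\<psi> q) R0 \<subseteq> \<psi> ` V" "\<And>y. y \<in> cball (\<psi> q) R0 \<Longrightarrow> snd y < 1"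
  proof -
    obtain T where T: "open T" "\<psi> ` V = (half_space \<times> {0..1}) \<inter> T" using chV(2) by (auto simp: openin_open)
    define O' where "O' = T \<inter> (interior half_space \<times> {0<..<1::real})"
    have "open O'" unfolding O'_def using T(1) by (intro open_Int open_Times) auto
    moreover have "\<psi> q \<in> T" using T(2) qV by blast
    then have "\<psi> q \<in> O'" using V0 by (cases q) (auto simp: O'_def \<psi>_def)
    ultimately obtain R0 where "R0 > 0" "cball (\<psi> q) R0 \<subseteq> O'" by (meson open_contains_cball)
    moreover have "O' \<subseteq> \<psi> ` V" unfolding T(2) O'_def using interior_subset by fastforce
    moreover have "snd y < 1" if "y \<in> O'" for y using that by (auto simp: O'_def)
    ultimately show ?thesis using that[of R0] by blast
  qed
  define e where "e = \<psi> \<circ> E \<circ> inv_into (U \<times> {0..1}) (map_prod \<phi> id)"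
  define S where "S = map_prod \<phi> id ` ((U \<times> {0..1}) \<inter> E -` V)"
  have S_iff: "(u, t) \<in> S \<longleftrightarrow> u \<in> \<phi> ` U \<and> t \<in> {0..1} \<and> E (\<phi>' u, t) \<in> V" for u t
  proof
    assume "(u, t) \<in> S"
    then obtain x where "x \<in> U" "u = \<phi> x" "t \<in> {0..1}" "E (x, t) \<in> V" by (auto simp: S_def)
    then show "u \<in> \<phi> ` U \<and> t \<in> {0..1} \<and> E (\<phi>' u, t) \<in> V" using \<phi>'\<phi> by simp
  next
    assume "u \<in> \<phi> ` U \<and> t \<in> {0..1} \<and> E (\<phi>' u, t) \<in> V"
    then show "(u, t) \<in> S"
      unfolding S_def using \<phi>'[of u] by (intro image_eqI[of _ _ "(\<phi>' u, t)"]) auto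
  qed
  have e_eq: "e (u, t) = \<psi> (E (\<phi>' u, t))" if "u \<in> \<phi> ` U" "t \<in> {0..1}" for u t
  proof -
    have "inj_on (map_prod \<phi> id) (U \<times> {0..1::real})" using chU(3) by (auto simp: inj_on_def)
    then have "inv_into (U \<times> {0..1}) (map_prod \<phi> id) (map_prod \<phi> id (\<phi>' u, t)) = (\<phi>' u, t)"
      using \<phi>' that by (intro inv_into_f_f) auto
    then show ?thesis using \<phi>' that by (simp add: e_def)
  qed
  have "(U \<times> {0..1}, map_prod \<phi> id) \<in> atlas (prod_manifold N unit_interval)"
    using U by (auto simp: prod_manifold_def unit_interval_def)
  then have "smooth_on S e" using smooth Vatlas unfolding smooth_map_def S_def e_def by blast
  have z0: "(a, t0) \<in> S" using U t0 qV \<phi>'\<phi> by (auto simp: S_iff a_def q_def)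
  obtain D where D: "bounded_linear D" and strict: "\<And>\<eta>. \<eta> > 0 \<Longrightarrow> \<exists>r>0. \<forall>y\<in>S \<inter> ball (a, t0) r.
      \<forall>y'\<in>S \<inter> ball (a, t0) r. norm (e y - e y' - D (y - y')) \<le> \<eta> * norm (y - y')"
    using smooth_on_strict_derivative[OF \<open>smooth_on S e\<close> z0] by blast
  obtain \<epsilon> where \<epsilon>: "\<epsilon> > 0" "ball (a, t0) \<epsilon> \<inter> (\<phi> ` U \<times> {0..1}) \<subseteq> S"
  proof -
    let ?P = "prod_topology (top_of_set (\<phi> ` U)) (top_of_set {0..1::real})"
    have "continuous_map ?P (prod_topology (mtop N) (top_of_set {0..1::real})) (\<lambda>z. (\<phi>' (fst z), snd z))"
      unfolding continuous_map_paired
      using continuous_map_compose[OF continuous_map_fst \<phi>'c] continuous_map_snd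
      unfolding o_def by blast
    from continuous_map_compose[OF this continuous_isotopy]
    have "continuous_map ?P ?X (\<lambda>z. E (\<phi>' (fst z), snd z))" by (simp only: o_def)
    from openin_continuous_map_preimage[OF this chV(1)]
    have "openin ?P {z \<in> topspace ?P. E (\<phi>' (fst z), snd z) \<in> V}" .
    moreover have "{z \<in> topspace ?P. E (\<phi>' (fst z), snd z) \<in> V} = S" using S_iff by auto
    ultimately have "openin (top_of_set (\<phi> ` U \<times> {0..1})) S" by simp
    then show ?thesis using z0 that unfolding openin_contains_ball by blast
  qed
  obtain \<epsilon>' where \<epsilon>': "\<epsilon>' > 0" "cball a \<epsilon>' \<subseteq> \<phi> ` U"
    using \<open>open (\<phi> ` U)\<close> U(2) unfolding a_def by (meson image_eqI open_contains_cball)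
  have inS: "(u, t) \<in> S" if "dist a u + \<bar>t0 - t\<bar> < \<epsilon>" "dist a u \<le> \<epsilon>'" "t \<in> {0..1}" for u t
  proof -
    have "dist (a, t0) (u, t) \<le> dist a u + \<bar>t0 - t\<bar>"
      using norm_Pair_le[of "a - u" "t0 - t"] by (simp add: dist_norm)
    then have "(u, t) \<in> ball (a, t0) \<epsilon> \<inter> (\<phi> ` U \<times> {0..1})" using that \<epsilon>' by auto
    then show ?thesis using \<epsilon> by blast
  qed
  have injD: "inj (\<lambda>v. D (v, 0))"
  proof -
    let ?S0 = "\<phi> ` (U \<inter> (\<lambda>x. E (x, t0)) -` V)" and ?e0 = "\<psi> \<circ> (\<lambda>x. E (x, t0)) \<circ> inv_into U \<phi>"
    have sub: "ball a (min \<epsilon> \<epsilon>') \<subseteq> ?S0"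
    proof
      fix u assume "u \<in> ball a (min \<epsilon> \<epsilon>')"
      then have "(u, t0) \<in> S" using inS[of u t0] t0 by auto
      then have "u \<in> \<phi> ` U" "E (\<phi>' u, t0) \<in> V" by (simp_all add: S_iff)
      then show "u \<in> ?S0" using \<phi>'[of u] by (intro image_eqI[of u \<phi> "\<phi>' u"]) simp_all
    qed
    have "smooth_immersion N (thick F) (\<lambda>x. E (x, t0))" using embed[OF t0] by (simp add: smooth_embedding_def)
    moreover have "p \<in> U \<inter> (\<lambda>x. E (x, t0)) -` V" using U qV by (simp add: q_def)
    ultimately obtain D' where D': "(?e0 has_derivative D') (at (\<phi> p) within ?S0)" "inj D'"
      using U(1) Vatlas unfolding smooth_immersion_def by blast
    have "a \<in> interior ?S0" using sub \<epsilon> \<epsilon>' by (intro interiorI[of "ball a (min \<epsilon> \<epsilon>')"]) auto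
    then have "at a within ?S0 = at a" by (rule at_within_interior)
    with D'(1) have 1: "(?e0 has_derivative D') (at a)" unfolding a_def by (simp only:)
    have "((\<lambda>u. e (u, t0)) has_derivative (\<lambda>v. D (v, 0))) (at a)"
    proof (rule has_derivative_slice[OF D _ _ strict])
      show "min \<epsilon> \<epsilon>' > 0" using \<epsilon> \<epsilon>' by simp
      show "(u, t0) \<in> S" if "u \<in> ball a (min \<epsilon> \<epsilon>')" for u using that inS[of u t0] t0 by auto
    qed
    then have "(?e0 has_derivative (\<lambda>v. D (v, 0))) (at a)"
    proof (rule has_derivative_transform_within_open[of _ _ _ _ "ball a (min \<epsilon> \<epsilon>')"])
      fix u assume "u \<in> ball a (min \<epsilon> \<epsilon>')"
      then have "u \<in> \<phi> ` U" using sub by auto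
      then show "e (u, t0) = ?e0 u" using e_eq t0 by (simp add: \<phi>'_def)
    qed (use \<epsilon> \<epsilon>' in auto)
    with 1 have "D' = (\<lambda>v. D (v, 0))" by (rule has_derivative_unique)
    with D'(2) show ?thesis by simp
  qed
  \<comment> \<open>after the coordinatewise extension, which multiplies it by the dimension, the constant is 1/2\<close>
  define k where "k = 1 / (2 * real DIM(((real^'n) \<times> real) \<times> real))"
  have k: "0 < k" "k \<le> 1" "real DIM(((real^'n) \<times> real) \<times> real) * k < 1"
  proof -
    have "real DIM(((real^'n) \<times> real) \<times> real) \<ge> 1"
      using DIM_positive[where 'a = "((real^'n) \<times> real) \<times> real"] by linarith
    then show "0 < k" "k \<le> 1" "real DIM(((real^'n) \<times> real) \<times> real) * k < 1"
      by (simp_all add: k_def field_simps)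
  qed
  obtain \<kappa> \<rho> C where pos: "\<kappa> > 0" "\<rho> > 0" "C > 0"
    and lipC: "\<And>y y'. y \<in> S \<inter> ball (a, t0) \<rho> \<Longrightarrow> y' \<in> S \<inter> ball (a, t0) \<rho> \<Longrightarrow> norm (e y - e y') \<le> C * norm (y - y')"
    and inj_e: "\<And>u u' s s'. (u, s) \<in> S \<inter> ball (a, t0) \<rho> \<Longrightarrow> (u', s') \<in> S \<inter> ball (a, t0) \<rho> \<Longrightarrow>
       \<bar>s - s'\<bar> \<le> \<kappa> * norm (u - u') \<Longrightarrow> e (u, s) = e (u', s') \<Longrightarrow> u = u'"
    and disp: "\<And>u u' s s' t t'. (u, s) \<in> S \<inter> ball (a, t0) \<rho> \<Longrightarrow> (u', s') \<in> S \<inter> ball (a, t0) \<rho> \<Longrightarrow>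
       (u, t) \<in> S \<inter> ball (a, t0) \<rho> \<Longrightarrow> (u', t') \<in> S \<inter> ball (a, t0) \<rho> \<Longrightarrow>
       \<bar>s - s'\<bar> \<le> \<kappa> * norm (u - u') \<Longrightarrow> \<bar>t - t'\<bar> \<le> \<kappa> * norm (u - u') \<Longrightarrow>
       norm ((e (u, t) - e (u, s)) - (e (u', t') - e (u', s'))) \<le> k * norm (e (u, s) - e (u', s'))"
    by (rule nearly_constant_time_displacement[OF D injD k(1,2) strict]) blast+
  \<comment> \<open>a third, since the distances in space and in time both contribute up to \<open>r\<close>\<close>
  define r where "r = min \<epsilon>' (min \<epsilon> \<rho> / 3)"
  have r: "0 < r" "r \<le> \<epsilon>'" "3 * r \<le> \<epsilon>" "3 * r \<le> \<rho>" using \<epsilon> \<epsilon>' pos by (auto simp: r_def)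
  have near: "(u, t) \<in> S \<inter> ball (a, t0) \<rho>" if "u \<in> cball a r" "t \<in> {0..1}" "\<bar>t - t0\<bar> < r" for u t
  proof
    show "(u, t) \<in> S" using that r by (intro inS) auto
    have "dist (a, t0) (u, t) \<le> dist a u + \<bar>t0 - t\<bar>"
      using norm_Pair_le[of "a - u" "t0 - t"] by (simp add: dist_norm)
    then show "(u, t) \<in> ball (a, t0) \<rho>" using that r by auto
  qed
  define K where "K = topspace (mtop N) - {x \<in> U. \<phi> x \<in> ball a r}"
  have Kcl: "closedin (mtop N) K"
  proof -
    have "openin (subtopology (mtop N) U) {x \<in> topspace (subtopology (mtop N) U). \<phi> x \<in> ball a r}"
      using chU(4) r \<epsilon>' \<open>open (\<phi> ` U)\<close>
      by (intro openin_continuous_map_preimage[where Y = "top_of_set (\<phi> ` U)"] open_subset)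
        (auto simp: homeomorphic_maps_def)
    moreover have "{x \<in> topspace (subtopology (mtop N) U). \<phi> x \<in> ball a r} = {x \<in> U. \<phi> x \<in> ball a r}"
      using Usub by auto
    ultimately have "openin (mtop N) {x \<in> U. \<phi> x \<in> ball a r}"
      using chU(1) openin_trans_full by metis
    then show ?thesis unfolding K_def by blast
  qed
  have "q \<notin> (\<lambda>x. E (x, t0)) ` K"
  proof
    assume "q \<in> (\<lambda>x. E (x, t0)) ` K"
    then obtain x where x: "x \<in> K" "E (p, t0) = E (x, t0)" by (auto simp: q_def)
    moreover have "inj_on (\<lambda>x. E (x, t0)) (topspace (mtop N))"
      using embed[OF t0] by (auto simp: smooth_embedding_def embedding_map_def
          dest: homeomorphic_imp_injective_map)
    ultimately have "x = p" using p by (auto simp: K_def inj_on_def)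
    with x(1) U r show False by (simp add: K_def a_def)
  qed
  from isotopy_avoids_far_points[OF manifolds(6) Kcl manifolds(3) continuous_isotopy t0 qV this chV(1,3) R0(1,2)]
  obtain R \<delta>1 where R: "0 < R" "R \<le> R0" and \<delta>1: "0 < \<delta>1"
    and far: "\<And>x t. x \<in> K \<Longrightarrow> t \<in> {0..1} \<Longrightarrow> \<bar>t - t0\<bar> < \<delta>1 \<Longrightarrow>
      \<not> (E (x, t) \<in> V \<and> \<psi> (E (x, t)) \<in> cball (\<psi> q) R)" by blast
  have eq: "e (a, t0) = \<psi> q" using e_eq[of a t0] U t0 \<phi>'\<phi> by (simp add: a_def q_def)
  define r' where "r' = min r (R / (8 * C))"
  define \<delta> where "\<delta> = min (min r \<delta>1) (min (R / (8 * C)) (k * R / (4 * C)))"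
  have r': "0 < r'" "r' \<le> r" "r' \<le> R / (8 * C)" using r R pos by (auto simp: r'_def)
  have \<delta>: "0 < \<delta>" "\<delta> \<le> r" "\<delta> \<le> \<delta>1" "\<delta> \<le> R / (8 * C)" "\<delta> \<le> k * R / (4 * C)"
    using r R pos \<delta>1 k by (auto simp: \<delta>_def)
  have mid: "e (u, t) \<in> ball (\<psi> q) (R/2)" if "u \<in> cball a r'" "t \<in> {0..1}" "\<bar>t - t0\<bar> < \<delta>" for u t
  proof -
    have "norm (e (u, t) - e (a, t0)) \<le> C * norm ((u, t) - (a, t0))"
      using that r r' \<delta> t0 by (intro lipC near) auto
    also have "\<dots> \<le> C * (norm (u - a) + norm (t - t0))"
      using pos norm_Pair_le[of "u - a" "t - t0"] by (intro mult_left_mono) auto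
    also have "\<dots> \<le> C * (R / (8 * C) + R / (8 * C))"
      using that r' \<delta> pos by (intro mult_left_mono add_mono) (auto simp: dist_norm norm_minus_commute)
    also have "\<dots> = R / 4" using pos by (simp add: field_simps)
    finally show ?thesis using R by (simp add: eq dist_norm norm_minus_commute)
  qed
  show ?thesis
  proof (rule that[OF U r'(1,2) pos(1) \<delta>(1)])
    show "cball (\<phi> p) r \<subseteq> \<phi> ` U" using \<epsilon>' r by (auto simp: a_def)
    fix \<sigma> \<tau> :: "'c \<Rightarrow> real"
    assume \<sigma>: "\<And>x. x \<in> topspace (mtop N) \<Longrightarrow> \<sigma> x \<in> {0..1} \<and> \<bar>\<sigma> x - t0\<bar> < \<delta>"
      and \<tau>: "\<And>x. x \<in> topspace (mtop N) \<Longrightarrow> \<tau> x \<in> {0..1} \<and> \<bar>\<tau> x - t0\<bar> < \<delta>"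
      and lip: "\<kappa>-lipschitz_on (cball (\<phi> p) r) (\<sigma> \<circ> inv_into U \<phi>)" "\<kappa>-lipschitz_on (cball (\<phi> p) r) (\<tau> \<circ> inv_into U \<phi>)"
      and supp: "\<And>x. x \<in> topspace (mtop N) \<Longrightarrow> \<sigma> x \<noteq> \<tau> x \<Longrightarrow> x \<in> U \<and> \<phi> x \<in> cball (\<phi> p) r'"
    define s where "s u = \<sigma> (\<phi>' u)" for u
    define t where "t u = \<tau> (\<phi>' u)" for u
    have ball_U: "u \<in> \<phi> ` U" "\<phi>' u \<in> topspace (mtop N)" if "u \<in> cball a r" for u
      using that \<epsilon>' r \<phi>' Usub by (auto simp: subset_iff)
    have s: "(u, s u) \<in> S \<inter> ball (a, t0) \<rho>" "s u \<in> {0..1}" "\<bar>s u - t0\<bar> < \<delta>"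
      and t: "(u, t u) \<in> S \<inter> ball (a, t0) \<rho>" "t u \<in> {0..1}" "\<bar>t u - t0\<bar> < \<delta>"
      if "u \<in> cball a r" for u
      using \<sigma>[OF ball_U(2)[OF that]] \<tau>[OF ball_U(2)[OF that]] near[OF that] \<delta>(2)
      by (auto simp: s_def t_def)
    have lip_s: "\<bar>s u - s u'\<bar> \<le> \<kappa> * norm (u - u')" and lip_t: "\<bar>t u - t u'\<bar> \<le> \<kappa> * norm (u - u')"
      if "u \<in> cball a r" "u' \<in> cball a r" for u u'
      using lipschitz_onD[OF lip(1), of u u'] lipschitz_onD[OF lip(2), of u u'] that
      by (auto simp: s_def t_def a_def \<phi>'_def dist_norm dist_real_def)
    define A where "A = {u \<in> cball a r. e (u, s u) \<in> ball (\<psi> q) R}"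
    define h where "h u = e (u, s u)" for u
    have "inj_on h A"
      by (rule inj_onI) (auto simp: A_def h_def intro: inj_e[OF s(1) s(1) lip_s])
    define d where "d y = e (inv_into A h y, t (inv_into A h y)) - y" for y
    have d: "d (h u) = e (u, t u) - e (u, s u)" if "u \<in> A" for u
    proof -
      have "inv_into A h (h u) = u" using that \<open>inj_on h A\<close> by simp
      then show ?thesis by (simp only: d_def) (simp add: h_def)
    qed
    have Acb: "u \<in> cball a r" if "u \<in> A" for u using that by (simp add: A_def)
    obtain f g where fg: "homeomorphism UNIV UNIV f g"
      and fd: "\<And>y. y \<in> h ` A \<Longrightarrow> f y = y + d y" and fout: "\<And>y. y \<notin> ball (\<psi> q) R \<Longrightarrow> f y = y"
    proof (rule small_displacement_homeomorphism[of R "h ` A" "\<psi> q" k d])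
      show "R > 0" "0 \<le> k" "real DIM(((real^'n) \<times> real) \<times> real) * k < 1" using R k by auto
      show "h ` A \<subseteq> ball (\<psi> q) R" by (auto simp: A_def h_def)
    next
      fix x y assume "x \<in> h ` A" "y \<in> h ` A"
      then obtain u u' where u: "u \<in> A" "x = h u" "u' \<in> A" "y = h u'" by blast
      show "norm (d x - d y) \<le> k * norm (x - y)"
        unfolding u(2,4) d[OF u(1)] d[OF u(3)] unfolding h_def
        using Acb[OF u(1)] Acb[OF u(3)] by (intro disp s(1) t(1) lip_s lip_t)
    next
      fix x assume "x \<in> h ` A" "d x \<noteq> 0"
      then obtain u where u: "u \<in> A" "x = h u" by blast
      then have "s u \<noteq> t u" using \<open>d x \<noteq> 0\<close> d[OF u(1)] by auto
      then have "\<phi> (\<phi>' u) \<in> cball (\<phi> p) r'"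
        using supp[OF ball_U(2)[OF Acb[OF u(1)]]] by (simp add: s_def t_def)
      then have "u \<in> cball a r'" using \<phi>'(2)[OF ball_U(1)[OF Acb[OF u(1)]]] by (simp add: a_def)
      then show "x \<in> ball (\<psi> q) (R/2)"
        unfolding u(2) h_def using s(2,3)[OF Acb[OF u(1)]] by (rule mid)
    next
      fix x assume "x \<in> h ` A"
      then obtain u where u: "u \<in> A" "x = h u" by blast
      note su = s[OF Acb[OF u(1)]] and tu = t[OF Acb[OF u(1)]]
      have "norm (d x) \<le> C * norm ((u, t u) - (u, s u))"
        unfolding u(2) d[OF u(1)] by (rule lipC[OF tu(1) su(1)])
      also have "\<dots> \<le> C * (2 * (k * R / (4 * C)))"
      proof (rule mult_left_mono)
        have "\<bar>t u - s u\<bar> \<le> 2 * (k * R / (4 * C))" using su(3) tu(3) \<delta>(5) by linarith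
        then show "norm ((u, t u) - (u, s u)) \<le> 2 * (k * R / (4 * C))" by (simp only: diff_Pair) simp
      qed (use pos in simp)
      also have "\<dots> = k * (R / 2)" using pos by simp
      finally show "norm (d x) \<le> k * (R / 2)" .
    qed blast
    have Rsub: "cball (\<psi> q) R \<subseteq> \<psi> ` V" using R R0 by auto
    obtain f' g' where f': "homeomorphic_maps ?X ?X f' g'"
      and f'in: "\<And>y. y \<in> V \<Longrightarrow> \<psi> y \<in> ball (\<psi> q) R \<Longrightarrow> f' y = \<psi>' (f (\<psi> y))"
      and f'out: "\<And>y. \<not> (y \<in> V \<and> \<psi> y \<in> ball (\<psi> q) R) \<Longrightarrow> f' y = y"
      using chart_supported_homeomorphism[OF manifolds(3) chV(1,3) Rsub fg fout] by blast
    have move: "f' (E (x, \<sigma> x)) = E (x, \<tau> x)" if x: "x \<in> topspace (mtop N)" for x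
    proof (cases "E (x, \<sigma> x) \<in> V \<and> \<psi> (E (x, \<sigma> x)) \<in> ball (\<psi> q) R")
      case True
      then have "x \<notin> K" using far[of x "\<sigma> x"] \<sigma>[OF x] \<delta>(3) ball_subset_cball by fastforce
      then have xU: "x \<in> U" "\<phi> x \<in> cball a r" using x by (auto simp: K_def)
      define u where "u = \<phi> x"
      have su: "s u = \<sigma> x" and tu: "t u = \<tau> x" using xU \<phi>'\<phi> by (simp_all add: s_def t_def u_def)
      have eu: "e (u, s u) = \<psi> (E (x, \<sigma> x))" "e (u, t u) = \<psi> (E (x, \<tau> x))"
        using e_eq[of u] s(2)[of u] t(2)[of u] xU \<phi>'\<phi> su tu by (simp_all add: u_def)
      have "u \<in> A" using True xU eu(1) by (simp add: A_def u_def)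
      have "f (\<psi> (E (x, \<sigma> x))) = f (h u)" by (simp add: h_def eu)
      also have "\<dots> = e (u, t u)" using fd[of "h u"] d[OF \<open>u \<in> A\<close>] \<open>u \<in> A\<close> by (simp add: h_def)
      finally have "f' (E (x, \<sigma> x)) = \<psi>' (\<psi> (E (x, \<tau> x)))" using f'in True eu(2) by simp
      moreover have "E (x, \<tau> x) \<in> V"
        using t(1)[OF Acb[OF \<open>u \<in> A\<close>]] tu xU \<phi>'\<phi> by (simp add: S_iff u_def)
      ultimately show ?thesis using \<psi>'\<psi> by simp
    next
      case False
      have "\<sigma> x = \<tau> x"
      proof (rule ccontr)
        assume "\<sigma> x \<noteq> \<tau> x"
        then have xU: "x \<in> U" "\<phi> x \<in> cball a r'" using supp[OF x] by (auto simp: a_def)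
        then have "\<phi> x \<in> cball a r" using r' by auto
        from s(1)[OF this] have "E (x, \<sigma> x) \<in> V" using xU \<phi>'\<phi> by (simp add: S_iff s_def)
        moreover have "e (\<phi> x, \<sigma> x) \<in> ball (\<psi> q) (R/2)" using mid xU(2) \<sigma>[OF x] by blast
        then have "\<psi> (E (x, \<sigma> x)) \<in> ball (\<psi> q) R"
          using e_eq[of "\<phi> x" "\<sigma> x"] xU \<phi>'\<phi> \<sigma>[OF x] R by auto
        ultimately show False using False by blast
      qed
      then show ?thesis using f'out[OF False] by simp
    qed
    have top: "f' y = y" if "snd y = 1" for y
    proof (rule f'out)
      show "\<not> (y \<in> V \<and> \<psi> y \<in> ball (\<psi> q) R)"
        using R0(3)[of "\<psi> y"] R(2) that by (cases y) (auto simp: \<psi>_def)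
    qed
    have "graph_link \<sigma> \<subseteq> topspace ?X"
      using inside \<sigma> thick_interior_subset[OF manifolds(1)] by blast
    from top_face_fixing_homeomorphism_hcomplement[OF f' top this]
    have "hcomplement F (graph_link \<sigma>) homeomorphic_space hcomplement F (f' ` graph_link \<sigma>)" by blast
    moreover have "f' ` graph_link \<sigma> = graph_link \<tau>"
      unfolding image_image by (rule image_cong) (use move in auto)
    ultimately show "hcomplement F (graph_link \<sigma>) homeomorphic_space hcomplement F (graph_link \<tau>)" by simp
  qed
qed

end

section \<open>Time functions\<close>

text \<open>Bump functions are built in one chart but must be estimated in all others. Being locally Lipschitz
  in every chart is preserved by the smooth transition maps and by maxima.\<close>

definition chart_lipschitz :: "('c, 'e::euclidean_space) smooth_space \<Rightarrow> ('c \<Rightarrow> real) \<Rightarrow> bool" where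
  "chart_lipschitz N f \<longleftrightarrow> (\<forall>(U, \<phi>)\<in>atlas N. \<forall>u\<in>\<phi> ` U.
     \<exists>r>0. \<exists>L. L-lipschitz_on (\<phi> ` U \<inter> ball u r) (f \<circ> inv_into U \<phi>))"

lemma chart_lipschitz_zero: "chart_lipschitz N (\<lambda>_. 0)"
  unfolding chart_lipschitz_def
proof clarify
  fix U \<phi> x
  have "0-lipschitz_on (\<phi> ` U \<inter> ball (\<phi> x) 1) ((\<lambda>_. 0) \<circ> inv_into U \<phi>)"
    by (rule lipschitz_onI) simp_all
  then show "\<exists>r>0. \<exists>L. L-lipschitz_on (\<phi> ` U \<inter> ball (\<phi> x) r) ((\<lambda>_. 0) \<circ> inv_into U \<phi>)"
    using zero_less_one by blast
qed

lemma chart_lipschitz_max: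
  assumes "chart_lipschitz N f" "chart_lipschitz N g"
  shows "chart_lipschitz N (\<lambda>x. max (f x) (g x))"
  unfolding chart_lipschitz_def
proof (clarify)
  fix U \<phi> x assume U: "(U, \<phi>) \<in> atlas N" "x \<in> U"
  obtain r L where r: "r > 0" "L-lipschitz_on (\<phi> ` U \<inter> ball (\<phi> x) r) (f \<circ> inv_into U \<phi>)"
    using assms(1) U unfolding chart_lipschitz_def by blast
  obtain s M where s: "s > 0" "M-lipschitz_on (\<phi> ` U \<inter> ball (\<phi> x) s) (g \<circ> inv_into U \<phi>)"
    using assms(2) U unfolding chart_lipschitz_def by blast
  have nn: "L \<ge> 0" "M \<ge> 0" using r(2) s(2) by (auto dest: lipschitz_on_nonneg)
  have "(L + M)-lipschitz_on (\<phi> ` U \<inter> ball (\<phi> x) (min r s)) ((\<lambda>x. max (f x) (g x)) \<circ> inv_into U \<phi>)"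
  proof (rule lipschitz_onI)
    fix y z assume y: "y \<in> \<phi> ` U \<inter> ball (\<phi> x) (min r s)" and z: "z \<in> \<phi> ` U \<inter> ball (\<phi> x) (min r s)"
    let ?y = "inv_into U \<phi> y" and ?z = "inv_into U \<phi> z"
    have "\<bar>f ?y - f ?z\<bar> \<le> L * dist y z"
      using lipschitz_onD[OF r(2), of y z] y z by (simp add: dist_real_def)
    moreover have "\<bar>g ?y - g ?z\<bar> \<le> M * dist y z"
      using lipschitz_onD[OF s(2), of y z] y z by (simp add: dist_real_def)
    moreover have "0 \<le> L * dist y z" "0 \<le> M * dist y z" using nn by simp_all
    ultimately have "\<bar>max (f ?y) (g ?y) - max (f ?z) (g ?z)\<bar> \<le> L * dist y z + M * dist y z" by linarith
    then show "dist (((\<lambda>x. max (f x) (g x)) \<circ> inv_into U \<phi>) y) (((\<lambda>x. max (f x) (g x)) \<circ> inv_into U \<phi>) z)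
        \<le> (L + M) * dist y z" by (simp add: dist_real_def distrib_right)
  qed (use nn in simp)
  then show "\<exists>r>0. \<exists>L. L-lipschitz_on (\<phi> ` U \<inter> ball (\<phi> x) r) ((\<lambda>x. max (f x) (g x)) \<circ> inv_into U \<phi>)"
    using r(1) s(1) by (intro exI[of _ "min r s"]) auto
qed

lemma chart_lipschitz_on_compact:
  assumes f: "chart_lipschitz N f" and U: "(U, \<phi>) \<in> atlas N" and K: "compact K" "K \<subseteq> \<phi> ` U"
  obtains L where "L-lipschitz_on K (f \<circ> inv_into U \<phi>)"
proof -
  have "local_lipschitz {0::real} K (\<lambda>_. f \<circ> inv_into U \<phi>)"
  proof (rule local_lipschitzI)
    fix t u assume "u \<in> K"
    then obtain x where x: "x \<in> U" "u = \<phi> x" using K(2) by blast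
    obtain r L where r: "r > 0" "L-lipschitz_on (\<phi> ` U \<inter> ball u r) (f \<circ> inv_into U \<phi>)"
      using f U x unfolding chart_lipschitz_def by blast
    have "L-lipschitz_on (cball u (r/2) \<inter> K) (f \<circ> inv_into U \<phi>)"
      by (rule lipschitz_on_subset[OF r(2)]) (use r(1) K in auto)
    then show "\<exists>r>0. \<exists>L. \<forall>t\<in>cball t r \<inter> {0}. L-lipschitz_on (cball u r \<inter> K) (f \<circ> inv_into U \<phi>)"
      using r(1) by (intro exI[of _ "r/2"]) auto
  qed
  then obtain L where "\<And>t. t \<in> {0::real} \<Longrightarrow> L-lipschitz_on K (f \<circ> inv_into U \<phi>)"
    by (rule local_lipschitz_compact_implies_lipschitz[OF _ K(1) compact_sing]) (auto intro: continuous_on_const)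
  then show ?thesis using that by blast
qed

lemma open_chart_image:
  assumes M: "smooth_manifold UNIV M" and U: "(U, \<phi>) \<in> atlas M" and W: "openin (mtop M) W" "W \<subseteq> U"
  shows "open (\<phi> ` W)"
proof -
  note ch = chart_properties[OF M U]
  have "open_map (subtopology (mtop M) U) (top_of_set (\<phi> ` U)) \<phi>"
    by (rule homeomorphic_imp_open_map[OF homeomorphic_maps_imp_map[OF ch(4)]])
  moreover have "openin (subtopology (mtop M) U) W"
    using W unfolding openin_subtopology by blast
  ultimately have "openin (top_of_set (\<phi> ` U)) (\<phi> ` W)" by (simp add: open_map_def)
  then show ?thesis using ch(2) openin_open_trans by simp
qed

text \<open>A truncated linear function of the distance in the chart. It is Lipschitz in the other charts where
  they overlap with this one, and it vanishes off the compact, hence closed, coordinate ball.\<close>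

lemma bump_function:
  assumes M: "smooth_manifold UNIV M" and p: "(U, \<phi>) \<in> atlas M"
    and r: "r > 0" "cball a r \<subseteq> \<phi> ` U"
  obtains \<eta> where "chart_lipschitz M \<eta>" "\<And>x. 0 \<le> \<eta> x" "\<And>x. \<eta> x \<le> 1"
    "\<And>x. x \<in> U \<Longrightarrow> \<phi> x \<in> ball a (r/2) \<Longrightarrow> \<eta> x = 1"
    "\<And>x. \<eta> x \<noteq> 0 \<Longrightarrow> x \<in> U \<and> \<phi> x \<in> cball a r"
proof -
  note chU = chart_properties[OF M p]
  have X: "Hausdorff_space (mtop M)" using M by (simp add: smooth_manifold_def)
  define b where "b u = max 0 (min 1 (2 - 2 * dist a u / r))" for u
  define \<eta> where "\<eta> x = (if x \<in> U then b (\<phi> x) else 0)" for x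
  have blip: "(2/r)-lipschitz_on A b" for A
  proof (rule lipschitz_onI)
    fix u v
    have "\<bar>dist a u - dist a v\<bar> \<le> dist u v"
      using dist_triangle[of a u v] dist_triangle[of a v u] by (simp add: abs_le_iff dist_commute)
    then have "\<bar>2 * dist a u / r - 2 * dist a v / r\<bar> \<le> 2 / r * dist u v"
    proof -
      have "2 * dist a u / r - 2 * dist a v / r = 2 / r * (dist a u - dist a v)"
        by (simp add: diff_divide_distrib right_diff_distrib)
      moreover have "\<bar>dist a u - dist a v\<bar> \<le> dist u v" by fact
      ultimately show ?thesis
        using r(1) by (simp only: abs_mult) (simp add: divide_right_mono)
    qed
    then show "dist (b u) (b v) \<le> 2 / r * dist u v"
      unfolding b_def dist_real_def by linarith
  qed (use r in simp)
  define C where "C = {x \<in> U. \<phi> x \<in> cball a r}"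
  have "C = inv_into U \<phi> ` cball a r"
  proof (intro equalityI subsetI)
    fix x assume "x \<in> C"
    then show "x \<in> inv_into U \<phi> ` cball a r"
      using chU(3) by (auto simp: C_def intro!: image_eqI[of x _ "\<phi> x"])
  next
    fix x assume "x \<in> inv_into U \<phi> ` cball a r"
    then obtain u where u: "u \<in> cball a r" "x = inv_into U \<phi> u" by blast
    then have "u \<in> \<phi> ` U" using r by blast
    then show "x \<in> C" using u by (simp add: C_def inv_into_into f_inv_into_f)
  qed
  moreover have "compactin (mtop M) (inv_into U \<phi> ` cball a r)"
  proof (rule image_compactin)
    show "compactin (top_of_set (\<phi> ` U)) (cball a r)" using r by (simp add: compactin_subtopology)
    show "continuous_map (top_of_set (\<phi> ` U)) (mtop M) (inv_into U \<phi>)"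
      using chU(4) by (auto simp: homeomorphic_maps_def intro: continuous_map_into_fulltopology)
  qed
  ultimately have Ccl: "closedin (mtop M) C" using X by (simp add: compactin_imp_closedin)
  have out: "\<eta> x = 0" if "x \<notin> C" for x
  proof -
    have "b u = 0" if "u \<notin> cball a r" for u
      using that r(1) by (auto simp: b_def field_simps max_def)
    then show ?thesis using that by (auto simp: \<eta>_def C_def)
  qed
  have "chart_lipschitz M \<eta>"
    unfolding chart_lipschitz_def
  proof clarify
    fix W \<psi> y assume W: "(W, \<psi>) \<in> atlas M" and y: "y \<in> W"
    note chW = chart_properties[OF M W]
    show "\<exists>s>0. \<exists>L. L-lipschitz_on (\<psi> ` W \<inter> ball (\<psi> y) s) (\<eta> \<circ> inv_into W \<psi>)"
    proof (cases "y \<in> C")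
      case True
      then have yU: "\<psi> y \<in> \<psi> ` (W \<inter> U)" using y by (auto simp: C_def)
      have sm: "smooth_on (\<psi> ` (W \<inter> U)) (\<phi> \<circ> inv_into W \<psi>)"
        using M W p unfolding smooth_manifold_def by blast
      obtain s L where s: "s > 0" "L-lipschitz_on (\<psi> ` (W \<inter> U) \<inter> ball (\<psi> y) s) (\<phi> \<circ> inv_into W \<psi>)"
        using smooth_on_imp_local_lipschitz[OF sm yU] by blast
      have "open (\<psi> ` (W \<inter> U))"
        using chW(1) chU(1) by (intro open_chart_image[OF M W]) auto
      then obtain s' where s': "s' > 0" "ball (\<psi> y) s' \<subseteq> \<psi> ` (W \<inter> U)"
        using yU by (meson open_contains_ball)
      have "(2/r * L)-lipschitz_on (\<psi> ` (W \<inter> U) \<inter> ball (\<psi> y) s) (b \<circ> (\<phi> \<circ> inv_into W \<psi>))"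
        by (rule lipschitz_on_compose[OF s(2) blip])
      then have "(2/r * L)-lipschitz_on (\<psi> ` W \<inter> ball (\<psi> y) (min s s')) (b \<circ> (\<phi> \<circ> inv_into W \<psi>))"
        by (rule lipschitz_on_subset) (use s'(2) in auto)
      moreover have "(\<eta> \<circ> inv_into W \<psi>) u = (b \<circ> (\<phi> \<circ> inv_into W \<psi>)) u"
        if u: "u \<in> \<psi> ` W \<inter> ball (\<psi> y) (min s s')" for u
      proof -
        have "u \<in> \<psi> ` (W \<inter> U)" using u s'(2) by auto
        then have "inv_into W \<psi> u \<in> U" using chW(3) by auto
        then show ?thesis by (simp add: \<eta>_def)
      qed
      ultimately have "(2/r * L)-lipschitz_on (\<psi> ` W \<inter> ball (\<psi> y) (min s s')) (\<eta> \<circ> inv_into W \<psi>)"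
        by (rule lipschitz_on_transform)
      then show ?thesis using s(1) s'(1) by (intro exI[of _ "min s s'"]) auto
    next
      case False
      have "openin (mtop M) (W - C)" using chW(1) Ccl by (rule openin_diff)
      then have "open (\<psi> ` (W - C))" by (rule open_chart_image[OF M W]) auto
      then obtain s where s: "s > 0" "ball (\<psi> y) s \<subseteq> \<psi> ` (W - C)"
        using y False unfolding open_contains_ball by blast
      have "(\<eta> \<circ> inv_into W \<psi>) u = 0" if u: "u \<in> ball (\<psi> y) s" for u
      proof -
        obtain x where "x \<in> W - C" "u = \<psi> x" using u s(2) by blast
        then show ?thesis using chW(3) out by simp
      qed
      then have "0-lipschitz_on (\<psi> ` W \<inter> ball (\<psi> y) s) (\<eta> \<circ> inv_into W \<psi>)"
        by (intro lipschitz_onI) (simp_all del: o_apply)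
      then show ?thesis using s(1) by blast
    qed
  qed
  then show ?thesis
  proof (rule that)
    show "0 \<le> \<eta> x" "\<eta> x \<le> 1" for x by (auto simp: \<eta>_def b_def)
    show "\<eta> x = 1" if "x \<in> U" "\<phi> x \<in> ball a (r/2)" for x
      using that r(1) by (auto simp: \<eta>_def b_def field_simps min_def)
    show "x \<in> U \<and> \<phi> x \<in> cball a r" if "\<eta> x \<noteq> 0" for x
      using that out by (auto simp: C_def)
  qed
qed

section \<open>Isotopy invariance\<close>

context link_isotopy
begin

text \<open>Raising the time function on the patch \<open>W\<close> to its final value. As the bump function \<open>\<eta>\<close> and the previous
  stage \<open>m\<close> have some Lipschitz constant in the chart, scaling by \<open>t - t0\<close> makes the time functions
  admissible for \<open>local_move\<close> once \<open>t\<close> is close to \<open>t0\<close>.\<close>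

lemma patch_move:
  assumes t0: "t0 \<in> {0..1}" and p: "p \<in> topspace (mtop N)"
  obtains W \<eta> where "openin (mtop N) W" "p \<in> W" "chart_lipschitz N \<eta>"
    "\<And>x. 0 \<le> \<eta> x" "\<And>x. \<eta> x \<le> 1" "\<And>x. x \<in> W \<Longrightarrow> \<eta> x = 1"
    "\<And>m. \<lbrakk>chart_lipschitz N m; \<And>x. 0 \<le> m x; \<And>x. m x \<le> 1\<rbrakk> \<Longrightarrow>
      \<exists>\<delta>>0. \<forall>t\<in>{0..1}. \<bar>t - t0\<bar> < \<delta> \<longrightarrow>
        hcomplement F (graph_link (\<lambda>x. t0 + (t - t0) * m x)) homeomorphic_space
        hcomplement F (graph_link (\<lambda>x. t0 + (t - t0) * max (\<eta> x) (m x)))"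
proof -
  obtain U \<phi> r r' \<kappa> \<delta> where U: "(U, \<phi>) \<in> atlas N" "p \<in> U" and r: "0 < r'" "r' \<le> r"
    and pos: "0 < \<kappa>" "0 < \<delta>" and cb: "cball (\<phi> p) r \<subseteq> \<phi> ` U"
    and move: "\<And>\<sigma> \<tau>. \<lbrakk>\<And>x. x \<in> topspace (mtop N) \<Longrightarrow> \<sigma> x \<in> {0..1} \<and> \<bar>\<sigma> x - t0\<bar> < \<delta>;
      \<And>x. x \<in> topspace (mtop N) \<Longrightarrow> \<tau> x \<in> {0..1} \<and> \<bar>\<tau> x - t0\<bar> < \<delta>;
      \<kappa>-lipschitz_on (cball (\<phi> p) r) (\<sigma> \<circ> inv_into U \<phi>); \<kappa>-lipschitz_on (cball (\<phi> p) r) (\<tau> \<circ> inv_into U \<phi>);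
      \<And>x. x \<in> topspace (mtop N) \<Longrightarrow> \<sigma> x \<noteq> \<tau> x \<Longrightarrow> x \<in> U \<and> \<phi> x \<in> cball (\<phi> p) r'\<rbrakk>
      \<Longrightarrow> hcomplement F (graph_link \<sigma>) homeomorphic_space hcomplement F (graph_link \<tau>)"
    by (rule local_move[OF t0 p]) blast
  have cb': "cball (\<phi> p) r' \<subseteq> \<phi> ` U" using cb r(2) by (meson order_trans subset_cball)
  obtain \<eta> where \<eta>: "chart_lipschitz N \<eta>" "\<And>x. 0 \<le> \<eta> x" "\<And>x. \<eta> x \<le> 1"
    "\<And>x. x \<in> U \<Longrightarrow> \<phi> x \<in> ball (\<phi> p) (r'/2) \<Longrightarrow> \<eta> x = 1"
    "\<And>x. \<eta> x \<noteq> 0 \<Longrightarrow> x \<in> U \<and> \<phi> x \<in> cball (\<phi> p) r'"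
    using bump_function[OF manifolds(4) U(1) r(1) cb'] by blast
  note chU = chart_properties[OF manifolds(4) U(1)]
  define W where "W = {x \<in> U. \<phi> x \<in> ball (\<phi> p) (r'/2)}"
  have "openin (mtop N) W"
  proof -
    have "ball (\<phi> p) (r'/2) \<subseteq> cball (\<phi> p) r'" using r(1) by auto
    then have "ball (\<phi> p) (r'/2) \<subseteq> \<phi> ` U" using cb' by blast
    then have "openin (subtopology (mtop N) U) {x \<in> topspace (subtopology (mtop N) U). \<phi> x \<in> ball (\<phi> p) (r'/2)}"
      using chU(4) by (intro openin_continuous_map_preimage[where Y = "top_of_set (\<phi> ` U)"] open_subset)
        (auto simp: homeomorphic_maps_def)
    moreover have "{x \<in> topspace (subtopology (mtop N) U). \<phi> x \<in> ball (\<phi> p) (r'/2)} = W"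
      using openin_subset[OF chU(1)] by (auto simp: W_def)
    ultimately show ?thesis using chU(1) openin_trans_full by metis
  qed
  moreover have "p \<in> W" using U r by (simp add: W_def)
  moreover note \<eta>(1-3)
  moreover have "\<And>x. x \<in> W \<Longrightarrow> \<eta> x = 1" using \<eta>(4) by (simp add: W_def)
  moreover have "\<exists>\<delta>>0. \<forall>t\<in>{0..1}. \<bar>t - t0\<bar> < \<delta> \<longrightarrow>
        hcomplement F (graph_link (\<lambda>x. t0 + (t - t0) * m x)) homeomorphic_space
        hcomplement F (graph_link (\<lambda>x. t0 + (t - t0) * max (\<eta> x) (m x)))"
    if m: "chart_lipschitz N m" "\<And>x. 0 \<le> m x" "\<And>x. m x \<le> 1" for m
  proof -
    obtain L where L: "L-lipschitz_on (cball (\<phi> p) r) (m \<circ> inv_into U \<phi>)"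
      using chart_lipschitz_on_compact[OF m(1) U(1) compact_cball cb] by blast
    obtain L' where L': "L'-lipschitz_on (cball (\<phi> p) r) ((\<lambda>x. max (\<eta> x) (m x)) \<circ> inv_into U \<phi>)"
      using chart_lipschitz_on_compact[OF chart_lipschitz_max[OF \<eta>(1) m(1)] U(1) compact_cball cb] by blast
    define \<delta>' where "\<delta>' = min \<delta> (\<kappa> / (L + L' + 1))"
    have nn: "0 \<le> L" "0 \<le> L'" using L L' by (auto dest: lipschitz_on_nonneg)
    have "\<delta>' > 0" using pos nn by (simp add: \<delta>'_def)
    have time: "t0 + (t - t0) * c \<in> {0..1} \<and> \<bar>t0 + (t - t0) * c - t0\<bar> < \<delta>"
      if t: "t \<in> {0..1}" "\<bar>t - t0\<bar> < \<delta>'" and c: "0 \<le> c" "c \<le> 1" for t c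
    proof -
      have "(1 - c) *\<^sub>R t0 + c *\<^sub>R t \<in> {0..1}"
        using t(1) t0 c by (intro convexD[OF convex_real_interval(5)]) auto
      moreover have "(1 - c) *\<^sub>R t0 + c *\<^sub>R t = t0 + (t - t0) * c" by (simp add: algebra_simps)
      moreover have "\<bar>t - t0\<bar> * c \<le> \<bar>t - t0\<bar>" using c by (simp add: mult_left_le)
      ultimately show ?thesis using t(2) c by (auto simp: abs_mult \<delta>'_def)
    qed
    have scale: "\<kappa>-lipschitz_on (cball (\<phi> p) r) ((\<lambda>x. t0 + (t - t0) * g x) \<circ> inv_into U \<phi>)"
      if t: "\<bar>t - t0\<bar> < \<delta>'" and g: "K-lipschitz_on (cball (\<phi> p) r) (g \<circ> inv_into U \<phi>)"
        and K: "K \<le> L + L'" for t g K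
    proof (rule lipschitz_onI)
      fix x y assume xy: "x \<in> cball (\<phi> p) r" "y \<in> cball (\<phi> p) r"
      have "0 \<le> K" using g by (rule lipschitz_on_nonneg)
      have "\<bar>t - t0\<bar> * K \<le> \<kappa> / (L + L' + 1) * (L + L' + 1)"
        using t K nn \<open>0 \<le> K\<close> pos by (intro mult_mono) (auto simp: \<delta>'_def)
      then have "\<bar>t - t0\<bar> * K \<le> \<kappa>" using nn by simp
      have "dist (((\<lambda>x. t0 + (t - t0) * g x) \<circ> inv_into U \<phi>) x) (((\<lambda>x. t0 + (t - t0) * g x) \<circ> inv_into U \<phi>) y)
          = \<bar>t - t0\<bar> * dist ((g \<circ> inv_into U \<phi>) x) ((g \<circ> inv_into U \<phi>) y)"
        by (simp add: dist_real_def flip: right_diff_distrib abs_mult)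
      also have "\<dots> \<le> \<bar>t - t0\<bar> * (K * dist x y)"
        using lipschitz_onD[OF g xy] by (intro mult_left_mono) auto
      also have "\<dots> \<le> \<kappa> * dist x y"
        using \<open>\<bar>t - t0\<bar> * K \<le> \<kappa>\<close> by (simp add: mult_right_mono flip: mult.assoc)
      finally show "dist (((\<lambda>x. t0 + (t - t0) * g x) \<circ> inv_into U \<phi>) x) (((\<lambda>x. t0 + (t - t0) * g x) \<circ> inv_into U \<phi>) y)
          \<le> \<kappa> * dist x y" .
    qed (use pos in simp)
    show ?thesis
    proof (intro exI[of _ \<delta>'] conjI ballI impI \<open>\<delta>' > 0\<close>)
      fix t assume t: "t \<in> {0..1}" "\<bar>t - t0\<bar> < \<delta>'"
      show "hcomplement F (graph_link (\<lambda>x. t0 + (t - t0) * m x)) homeomorphic_space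
        hcomplement F (graph_link (\<lambda>x. t0 + (t - t0) * max (\<eta> x) (m x)))"
      proof (rule move)
        show "\<kappa>-lipschitz_on (cball (\<phi> p) r) ((\<lambda>x. t0 + (t - t0) * m x) \<circ> inv_into U \<phi>)"
          using t(2) L nn by (intro scale) auto
        show "\<kappa>-lipschitz_on (cball (\<phi> p) r) ((\<lambda>x. t0 + (t - t0) * max (\<eta> x) (m x)) \<circ> inv_into U \<phi>)"
          by (rule scale[OF t(2) L']) (use nn in simp)
        fix x
        show "t0 + (t - t0) * m x \<in> {0..1} \<and> \<bar>t0 + (t - t0) * m x - t0\<bar> < \<delta>"
          using m by (intro time[OF t]) auto
        show "t0 + (t - t0) * max (\<eta> x) (m x) \<in> {0..1} \<and> \<bar>t0 + (t - t0) * max (\<eta> x) (m x) - t0\<bar> < \<delta>"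
          using m \<eta>(2,3) by (intro time[OF t]) (auto simp: le_max_iff_disj)
        assume "t0 + (t - t0) * m x \<noteq> t0 + (t - t0) * max (\<eta> x) (m x)"
        then have "\<eta> x \<noteq> 0" using m(2)[of x] by (auto simp: max_def split: if_splits)
        then show "x \<in> U \<and> \<phi> x \<in> cball (\<phi> p) r'" by (rule \<eta>(5))
      qed
    qed
  qed
  ultimately show ?thesis by (rule that)
qed

text \<open>Finitely many patches cover \<open>N\<close>. The maximum \<open>m\<close> of the first few bump functions is \<open>1\<close> on the
  patches treated so far, and on all of \<open>N\<close> in the end, so that the time function \<open>t0 + (t - t0) * m\<close>
  passes from \<open>t0\<close> to \<open>t\<close>.\<close>

lemma locally_constant_complement:
  assumes t0: "t0 \<in> {0..1}"
  shows "\<exists>\<delta>>0. \<forall>t\<in>{0..1}. \<bar>t - t0\<bar> < \<delta> \<longrightarrow>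
    hcomplement F (graph_link (\<lambda>_. t0)) homeomorphic_space hcomplement F (graph_link (\<lambda>_. t))"
proof -
  define good where "good W \<eta> \<longleftrightarrow> openin (mtop N) W \<and> chart_lipschitz N \<eta> \<and> (\<forall>x. 0 \<le> \<eta> x \<and> \<eta> x \<le> 1) \<and>
    (\<forall>x\<in>W. \<eta> x = 1) \<and> (\<forall>m. chart_lipschitz N m \<longrightarrow> (\<forall>x. 0 \<le> m x \<and> m x \<le> 1) \<longrightarrow>
      (\<exists>\<delta>>0. \<forall>t\<in>{0..1}. \<bar>t - t0\<bar> < \<delta> \<longrightarrow>
        hcomplement F (graph_link (\<lambda>x. t0 + (t - t0) * m x)) homeomorphic_space
        hcomplement F (graph_link (\<lambda>x. t0 + (t - t0) * max (\<eta> x) (m x)))))" for W and \<eta> :: "'c \<Rightarrow> real"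
  define \<W> where "\<W> = {W. \<exists>\<eta>. good W \<eta>}"
  have "\<exists>W\<in>\<W>. p \<in> W" if "p \<in> topspace (mtop N)" for p
  proof (rule patch_move[OF t0 that], goal_cases)
    case (1 W \<eta>)
    have "good W \<eta>" unfolding good_def using 1(1,3-7) by simp
    with 1(2) show ?case by (auto simp: \<W>_def)
  qed
  then have "topspace (mtop N) \<subseteq> \<Union>\<W>" by blast
  moreover have "\<forall>W\<in>\<W>. openin (mtop N) W" by (auto simp: \<W>_def good_def)
  ultimately obtain \<V> where \<V>: "finite \<V>" "\<V> \<subseteq> \<W>" "topspace (mtop N) \<subseteq> \<Union>\<V>"
    using manifolds(6) unfolding compact_space_alt by meson
  have "\<exists>m. chart_lipschitz N m \<and> (\<forall>x. 0 \<le> m x \<and> m x \<le> 1) \<and> (\<forall>x\<in>\<Union>\<V>. m x = 1) \<and>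
      (\<exists>\<delta>>0. \<forall>t\<in>{0..1}. \<bar>t - t0\<bar> < \<delta> \<longrightarrow> hcomplement F (graph_link (\<lambda>_. t0)) homeomorphic_space
        hcomplement F (graph_link (\<lambda>x. t0 + (t - t0) * m x)))"
    using \<V>(1,2)
  proof induction
    case empty
    show ?case
    proof (intro exI[of _ "\<lambda>_. 0"] conjI)
      show "\<exists>\<delta>>0. \<forall>t\<in>{0..1}. \<bar>t - t0\<bar> < \<delta> \<longrightarrow> hcomplement F (graph_link (\<lambda>_. t0)) homeomorphic_space
        hcomplement F (graph_link (\<lambda>x. t0 + (t - t0) * 0))"
        by (intro exI[of _ "1::real"]) (simp add: homeomorphic_space_refl)
    qed (simp_all add: chart_lipschitz_zero)
  next
    case (insert W \<V>)
    then obtain m \<delta>1 where m: "chart_lipschitz N m" "\<forall>x. 0 \<le> m x \<and> m x \<le> 1" "\<forall>x\<in>\<Union>\<V>. m x = 1"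
      and \<delta>1: "\<delta>1 > 0" "\<And>t. t \<in> {0..1} \<Longrightarrow> \<bar>t - t0\<bar> < \<delta>1 \<Longrightarrow> hcomplement F (graph_link (\<lambda>_. t0)) homeomorphic_space
        hcomplement F (graph_link (\<lambda>x. t0 + (t - t0) * m x))" by auto
    obtain \<eta> where "good W \<eta>" using insert.prems by (auto simp: \<W>_def)
    then have \<eta>: "chart_lipschitz N \<eta>" "\<forall>x. 0 \<le> \<eta> x \<and> \<eta> x \<le> 1" "\<forall>x\<in>W. \<eta> x = 1"
      and step: "\<exists>\<delta>>0. \<forall>t\<in>{0..1}. \<bar>t - t0\<bar> < \<delta> \<longrightarrow>
        hcomplement F (graph_link (\<lambda>x. t0 + (t - t0) * m x)) homeomorphic_space
        hcomplement F (graph_link (\<lambda>x. t0 + (t - t0) * max (\<eta> x) (m x)))"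
      using m unfolding good_def by blast+
    from step obtain \<delta>2 where \<delta>2: "\<delta>2 > 0" "\<And>t. t \<in> {0..1} \<Longrightarrow> \<bar>t - t0\<bar> < \<delta>2 \<Longrightarrow>
        hcomplement F (graph_link (\<lambda>x. t0 + (t - t0) * m x)) homeomorphic_space
        hcomplement F (graph_link (\<lambda>x. t0 + (t - t0) * max (\<eta> x) (m x)))" by blast
    show ?case
    proof (intro exI[of _ "\<lambda>x. max (\<eta> x) (m x)"] conjI)
      show "chart_lipschitz N (\<lambda>x. max (\<eta> x) (m x))" using \<eta>(1) m(1) by (rule chart_lipschitz_max)
      show "\<forall>x. 0 \<le> max (\<eta> x) (m x) \<and> max (\<eta> x) (m x) \<le> 1" using \<eta>(2) m(2) by (auto simp: le_max_iff_disj)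
      show "\<forall>x\<in>\<Union>(insert W \<V>). max (\<eta> x) (m x) = 1"
        using \<eta>(2,3) m(2,3) by (auto simp: max_def intro: antisym)
      show "\<exists>\<delta>>0. \<forall>t\<in>{0..1}. \<bar>t - t0\<bar> < \<delta> \<longrightarrow> hcomplement F (graph_link (\<lambda>_. t0)) homeomorphic_space
        hcomplement F (graph_link (\<lambda>x. t0 + (t - t0) * max (\<eta> x) (m x)))"
      proof (intro exI[of _ "min \<delta>1 \<delta>2"] conjI ballI impI)
        fix t assume "t \<in> {0..1}" "\<bar>t - t0\<bar> < min \<delta>1 \<delta>2"
        then show "hcomplement F (graph_link (\<lambda>_. t0)) homeomorphic_space
            hcomplement F (graph_link (\<lambda>x. t0 + (t - t0) * max (\<eta> x) (m x)))"
          by (intro homeomorphic_space_trans[OF \<delta>1(2) \<delta>2(2)]) auto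
      qed (use \<delta>1 \<delta>2 in simp)
    qed
  qed
  then obtain m where m: "\<forall>x\<in>\<Union>\<V>. m x = 1"
    and ex: "\<exists>\<delta>>0. \<forall>t\<in>{0..1}. \<bar>t - t0\<bar> < \<delta> \<longrightarrow> hcomplement F (graph_link (\<lambda>_. t0)) homeomorphic_space
        hcomplement F (graph_link (\<lambda>x. t0 + (t - t0) * m x))" 
    by (elim exE conjE) (rule that, assumption, intro exI conjI)
  have "graph_link (\<lambda>x. t0 + (t - t0) * m x) = graph_link (\<lambda>_. t)" for t
    by (rule image_cong) (use m \<V>(3) in auto)
  with ex show ?thesis by (simp only:)
qed

lemma ends_homeomorphic:
  "hcomplement F (graph_link (\<lambda>_. 0)) homeomorphic_space hcomplement F (graph_link (\<lambda>_. 1))"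
proof (rule connected_equivalence_relation[where S = "{0..1::real}" and a = 0 and b = 1
      and R = "\<lambda>s t. hcomplement F (graph_link (\<lambda>_. s)) homeomorphic_space hcomplement F (graph_link (\<lambda>_. t))"])
  fix t0 :: real assume t0: "t0 \<in> {0..1}"
  then obtain \<delta> where \<delta>: "\<delta> > 0" "\<And>t. t \<in> {0..1} \<Longrightarrow> \<bar>t - t0\<bar> < \<delta> \<Longrightarrow>
    hcomplement F (graph_link (\<lambda>_. t0)) homeomorphic_space hcomplement F (graph_link (\<lambda>_. t))"
    using locally_constant_complement by blast
  show "\<exists>T. openin (top_of_set {0..1}) T \<and> t0 \<in> T \<and> (\<forall>t\<in>T.
      hcomplement F (graph_link (\<lambda>_. t0)) homeomorphic_space hcomplement F (graph_link (\<lambda>_. t)))"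
  proof (intro exI[of _ "{0..1} \<inter> ball t0 \<delta>"] conjI ballI)
    show "openin (top_of_set {0..1}) ({0..1} \<inter> ball t0 \<delta>)" by (simp add: openin_open_Int)
    fix t assume "t \<in> {0..1} \<inter> ball t0 \<delta>"
    then show "hcomplement F (graph_link (\<lambda>_. t0)) homeomorphic_space hcomplement F (graph_link (\<lambda>_. t))"
      by (intro \<delta>(2)) (auto simp: dist_real_def)
  qed (use t0 \<delta> in auto)
next
  show "hcomplement F (graph_link (\<lambda>_. t)) homeomorphic_space hcomplement F (graph_link (\<lambda>_. s))"
    if "hcomplement F (graph_link (\<lambda>_. s)) homeomorphic_space hcomplement F (graph_link (\<lambda>_. t))" for s t
    using that by (rule homeomorphic_space_sym[THEN iffD1])
  show "hcomplement F (graph_link (\<lambda>_. s)) homeomorphic_space hcomplement F (graph_link (\<lambda>_. u))"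
    if "hcomplement F (graph_link (\<lambda>_. s)) homeomorphic_space hcomplement F (graph_link (\<lambda>_. t))"
      "hcomplement F (graph_link (\<lambda>_. t)) homeomorphic_space hcomplement F (graph_link (\<lambda>_. u))" for s t u
    using that by (rule homeomorphic_space_trans)
qed simp_all

end

lemma isotopic_homotopy_equivalent:
  fixes F1 F2 :: "('a, (real^'n) \<times> real) smooth_space"
  assumes p: "(F1, L1) \<in> thick_links" and iso: "smoothly_isotopic (F1, L1) (F2, L2)"
  shows "hcomplement F1 L1 homotopy_equivalent_space hcomplement F2 L2"
proof -
  obtain N :: "('a \<times> real, real^'n) smooth_space" and E where same: "F1 = F2"
    and N: "closed_manifold N" "smooth_map (prod_manifold N unit_interval) (thick F1) E"
    and t: "\<forall>t\<in>{0..1}. smooth_embedding N (thick F1) (\<lambda>x. E (x, t)) \<and>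
           (\<lambda>x. E (x, t)) ` topspace (mtop N) \<subseteq> thick_interior F1"
    and L: "(\<lambda>x. E (x, 0)) ` topspace (mtop N) = L1" "(\<lambda>x. E (x, 1)) ` topspace (mtop N) = L2"
    using iso by auto
  interpret link_isotopy F1 N E
  proof
    show "compact_manifold_bd F1" using p by (simp add: thick_links_def)
    show "closed_manifold N" "smooth_map (prod_manifold N unit_interval) (thick F1) E" by fact+
    fix s :: real assume "s \<in> {0..1}"
    with t show "smooth_embedding N (thick F1) (\<lambda>x. E (x, s))" by blast
    fix x assume "x \<in> topspace (mtop N)"
    with t \<open>s \<in> {0..1}\<close> show "E (x, s) \<in> thick_interior F1" by blast
  qed
  show ?thesis using homeomorphic_imp_homotopy_equivalent_space[OF ends_homeomorphic]
    unfolding L same[symmetric] .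
qed

theorem theorem19:
  fixes F1 F2 :: "('a, (real^'n) \<times> real) smooth_space"
    and L1 L2 :: "('a \<times> real) set"
  assumes "(F1, L1) \<in> thick_links" and "(F2, L2) \<in> thick_links"
    and "virtually_equivalent (F1, L1) (F2, L2)"
  shows "(hcomplement F1 L1) homotopy_equivalent_space (hcomplement F2 L2)"
proof -
  let ?h = "\<lambda>p :: ('a, (real^'n) \<times> real) smooth_space \<times> ('a \<times> real) set. hcomplement (fst p) (snd p)"
  let ?r = "\<lambda>p q :: ('a, (real^'n) \<times> real) smooth_space \<times> ('a \<times> real) set.
    p \<in> thick_links \<and> q \<in> thick_links \<and> (embedding_related p q \<or> smoothly_isotopic p q)"
  have move: "?h p homotopy_equivalent_space ?h q" if "?r p q" for p q
    using that embedding_related_homotopy_equivalent[of "fst p" "snd p" "fst q" "snd q"]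
      isotopic_homotopy_equivalent[of "fst p" "snd p" "fst q" "snd q"] by auto
  have "equivclp ?r (F1, L1) (F2, L2)" using assms(3) by (simp add: virtually_equivalent_def)
  then have "?h (F1, L1) homotopy_equivalent_space ?h (F2, L2)"
  proof (induction rule: equivclp_induct)
    case base
    show ?case by (rule homotopy_equivalent_space_refl)
  next
    case (step p q)
    from step(2) have "?h p homotopy_equivalent_space ?h q"
    proof
      assume "?r q p"
      then have "?h q homotopy_equivalent_space ?h p" by (rule move)
      then show ?thesis by (rule homotopy_equivalent_space_sym[THEN iffD1])
    qed (rule move)
    with step(3) show ?case by (rule homotopy_eqv_trans)
  qed
  then show ?thesis by simp
qed

end
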